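(* Let $d\ge 2$, let $R\subset X^d$ be a region, let $f\in\Omega$ be a height function, and let $T=T(f)$. Let $K$ be the Kasteleyn hypermatrix associated with $(R,T)$, and let $Z$ be the partition function of the uniform probability measure on $\Theta(R,T)$ (the Boltzmann measure with weight identically $1$). Then \[Z=|\Omega(R,f)|=|\Theta(R,T)|=\pm\operatorname{Det}K .\]
   Context: Fix an integer $d\ge 2$. Let $\mathbf e_1,\dots,\mathbf e_{d+1}$ be the standard basis of $\mathbb R^{d+1}$, $\mathbf n=\mathbf e_1+\dots+\mathbf e_{d+1}$, $H=\mathbf n^\perp\subset\mathbb R^{d+1}$, $P$ the orthogonal projection onto $H$, and $\mathbf g_i=P\mathbf e_i=\mathbf e_i-\mathbf n/(d+1)$. The simplicial lattice $(X^d,E^d)$ is the graph with vertex set $X^d=P(\mathbb Z^{d+1})\subset H$ (equivalently $\mathbb Z^{d+1}/\mathbb Z\mathbf n$) and edges $\{\mathbf x,\mathbf x+\mathbf g_i\}$, $\mathbf x\in X^d$, $1\le i\le d+1$. A height function is a function $f:X^d\to\mathbb Z$ with $f(\mathbf 0)\in(d+1)\mathbb Z$ and $f(\mathbf x+\mathbf g_i)-f(\mathbf x)\in\{1,-d\}$ for all $\mathbf x\in X^d$ and $i$. $\Omega$ is the set of height functions. For $f\in\Omega$, $T(f):=\{\{\mathbf x,\mathbf x+\mathbf g_i\}\in E^d: f(\mathbf x+\mathbf g_i)-f(\mathbf x)=-d\}$. A (rooted) simplicial loop is a closed path $(\mathbf s_k)_{0\le k\le d+1}$ in $X^d$ with $\mathbf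 s_k=\mathbf s_{k-1}+\mathbf g_{\xi(k)}$ for some permutation $\xi$ of $\{1,\dots,d+1\}$; an unrooted simplicial loop is such a loop up to cyclic re-indexing, and $U^d$ is the set of these. A tiling is a set $T\subset E^d$ containing exactly one edge of every simplicial loop; $\Theta$ is the set of tilings. A region is a finite set $R\subset X^d$ whose complement $R^{\mathsf c}=X^d\smallsetminus R$ is connected in $(X^d,E^d)$. $E^d(R)$ is the set of edges incident to at least one vertex of $R$. $\Omega(R,f):=\{g\in\Omega: g|_{R^{\mathsf c}}=f|_{R^{\mathsf c}}\}$ and $\Theta(R,T):=\{Y\in\Theta:Y\smallsetminus E^d(R)=T\smallsetminus E^d(R)\}$. For a weight $w$ on $E^d(R)$ the partition function is $Z_w=\sum_{Y\in\Theta(R,T)}\prod_{e\in Y\cap E^d(R)}w(e)$; $Z$ is $Z_w$ for $w\equiv1$. Each unrooted simplicial loop is indexed so that its first increment is $\mathbf g_{d+1}$, and is identified with the pair $(\mathbf x,\xi)\in X^d\times S_d$ of its starting point $\mathbf x$ and the order $\xi$ in which the remaining increments $\mathbf g_1,\dots,\mathbf g_d$ appear; this gives a bijection $U^d\cong X^d\times S_d$. Fix an enumeration $S_d=\{\xi^1,\dots,\xi^{d!}\}$. For $e\in E^d$, $h(e)\subset U^d$ is the set of unrooted simplicial loops traversing $e$ (the map $e\mapsto h(e)$ is injective, and $h(e)$ contains exactly one loop in $X^d\times\{\xi\}$ for each $\xi\in S_d$); $h(E^d(R))=\{h(e):e\in E^d(R)\}$. For $1\le i\le d!$ let $X_i$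 be the set of loops $(\mathbf x,\xi^i)\in X^d\times\{\xi^i\}$ that traverse an edge of $T\cap E^d(R)$; all $X_i$ have the same finite size $n=|T\cap E^d(R)|$. The Kasteleyn hypermatrix is $K:X_1\times\dots\times X_{d!}\to\{0,1\}$, with $K(\mathbf s_1,\dots,\mathbf s_{d!})=1$ if $\{\mathbf s_1,\dots,\mathbf s_{d!}\}\in h(E^d(R))$ and $0$ otherwise. Each $X_i$ is identified with $[n]=\{1,\dots,n\}$ through some arbitrary fixed enumeration. For even $m$ and $A:[n]^m\to\mathbb C$, the Cayley hyperdeterminant is \[\operatorname{Det}A:=\sum_{\sigma_2,\dots,\sigma_m\in S_n}\Big(\prod_{i=2}^m\operatorname{Sign}\sigma_i\Big)\prod_{k=1}^nA(k,\sigma_2(k),\dots,\sigma_m(k)).\] *)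

theory Defs
  imports
    Complex_Main
    "HOL-Library.FuncSet"
    "HOL-Library.Function_Algebras"
    "HOL-Combinatorics.Permutations"
begin

section \<open>The simplicial lattice\<close>

text \<open>
  A vector of \<open>\<real>\<^sup>d\<^sup>+\<^sup>1\<close> is a function \<open>nat \<Rightarrow> real\<close> whose coordinates are indexed by \<open>{1..d+1}\<close>
  and which vanishes at all other indices; \<open>+\<close> and \<open>0\<close> are the pointwise operations.
\<close>

type_synonym point = "nat \<Rightarrow> real"

definition unit_vec :: "nat \<Rightarrow> point" where
  "unit_vec i = (\<lambda>j. if j = i then 1 else 0)"

definition normal_vec :: "nat \<Rightarrow> point" where
  "normal_vec d = (\<Sum>i\<in>{1..d+1}. unit_vec i)"

definition dot :: "nat \<Rightarrow> point \<Rightarrow> point \<Rightarrow> real" where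
  "dot d x y = (\<Sum>i\<in>{1..d+1}. x i * y i)"

definition proj :: "nat \<Rightarrow> point \<Rightarrow> point" where
  "proj d x = (\<lambda>j. x j - dot d x (normal_vec d) / dot d (normal_vec d) (normal_vec d) * normal_vec d j)"

definition gen :: "nat \<Rightarrow> nat \<Rightarrow> point" where
  "gen d i = proj d (unit_vec i)"

definition int_lattice :: "nat \<Rightarrow> point set" where
  "int_lattice d = {x. (\<forall>i\<in>{1..d+1}. x i \<in> \<int>) \<and> (\<forall>i. i \<notin> {1..d+1} \<longrightarrow> x i = 0)}"

definition simplicial_lattice :: "nat \<Rightarrow> point set" where
  "simplicial_lattice d = proj d ` int_lattice d"

definition lattice_edges :: "nat \<Rightarrow> point set set" where
  "lattice_edges d = {{x, x + gen d i} | x i. x \<in> simplicial_lattice d \<and> i \<in> {1..d+1}}"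


section \<open>Height functions and tilings\<close>

text \<open>
  Functions on the lattice are made extensional, so that they are determined by their values on
  the lattice and can be counted.
\<close>

definition height_functions :: "nat \<Rightarrow> (point \<Rightarrow> int) set" where
  "height_functions d = {f \<in> extensional (simplicial_lattice d).
     (int d + 1) dvd f 0 \<and>
     (\<forall>x\<in>simplicial_lattice d. \<forall>i\<in>{1..d+1}. f (x + gen d i) - f x \<in> {1, - int d})}"

definition tiling_of :: "nat \<Rightarrow> (point \<Rightarrow> int) \<Rightarrow> point set set" where
  "tiling_of d f = {{x, x + gen d i} | x i.
     x \<in> simplicial_lattice d \<and> i \<in> {1..d+1} \<and> f (x + gen d i) - f x = - int d}"

definition rooted_loops :: "nat \<Rightarrow> (nat \<Rightarrow> point) set" where
  "rooted_loops d = {s \<in> {0..d+1} \<rightarrow>\<^sub>E simplicial_lattice d. s (d+1) = s 0 \<and>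
     (\<exists>\<xi>. \<xi> permutes {1..d+1} \<and> (\<forall>k\<in>{1..d+1}. s k = s (k-1) + gen d (\<xi> k)))}"

definition path_edges :: "nat \<Rightarrow> (nat \<Rightarrow> point) \<Rightarrow> point set set" where
  "path_edges d s = (\<lambda>k. {s (k-1), s k}) ` {1..d+1}"

definition tilings :: "nat \<Rightarrow> point set set set" where
  "tilings d = {Y. Y \<subseteq> lattice_edges d \<and> (\<forall>s\<in>rooted_loops d. card (Y \<inter> path_edges d s) = 1)}"


section \<open>Regions and the partition function\<close>

definition region :: "nat \<Rightarrow> point set \<Rightarrow> bool" where
  "region d R \<longleftrightarrow> R \<subseteq> simplicial_lattice d \<and> finite R \<and>
     (\<forall>x\<in>simplicial_lattice d - R. \<forall>y\<in>simplicial_lattice d - R.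
        (x, y) \<in> {(u, v). u \<in> simplicial_lattice d - R \<and> v \<in> simplicial_lattice d - R \<and> {u, v} \<in> lattice_edges d}\<^sup>*)"

definition region_edges :: "nat \<Rightarrow> point set \<Rightarrow> point set set" where
  "region_edges d R = {e \<in> lattice_edges d. e \<inter> R \<noteq> {}}"

definition height_functions_on :: "nat \<Rightarrow> point set \<Rightarrow> (point \<Rightarrow> int) \<Rightarrow> (point \<Rightarrow> int) set" where
  "height_functions_on d R f = {g \<in> height_functions d. \<forall>x\<in>simplicial_lattice d - R. g x = f x}"

definition tilings_on :: "nat \<Rightarrow> point set \<Rightarrow> point set set \<Rightarrow> point set set set" where
  "tilings_on d R T = {Y \<in> tilings d. Y - region_edges d R = T - region_edges d R}"

definition partition_fun :: "nat \<Rightarrow> point set \<Rightarrow> point set set \<Rightarrow> (point set \<Rightarrow> real) \<Rightarrow> real" where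
  "partition_fun d R T w = (\<Sum>Y\<in>tilings_on d R T. \<Prod>e\<in>Y \<inter> region_edges d R. w e)"


section \<open>Unrooted simplicial loops\<close>

definition reindex :: "nat \<Rightarrow> nat \<Rightarrow> (nat \<Rightarrow> point) \<Rightarrow> (nat \<Rightarrow> point)" where
  "reindex d j s = (\<lambda>k\<in>{0..d+1}. s ((k + j) mod (d+1)))"

definition unrooted :: "nat \<Rightarrow> (nat \<Rightarrow> point) \<Rightarrow> (nat \<Rightarrow> point) set" where
  "unrooted d s = {reindex d j s | j. j \<le> d}"

text \<open>
  A pair \<open>(x, \<xi>)\<close> with \<open>\<xi> \<in> S\<^sub>d\<close> stands for the unrooted simplicial loop that leaves \<open>x\<close> along
  \<open>gen d (d+1)\<close> and then takes the remaining increments in the order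
  \<open>gen d (\<xi> 1), \<dots>, gen d (\<xi> d)\<close>. That this identifies \<open>simplicial_lattice d \<times> S\<^sub>d\<close> with the set of unrooted
  loops is \<open>bij_betw_loops\<close> below.
\<close>

type_synonym simplicial_loop = "point \<times> (nat \<Rightarrow> nat)"

definition loops :: "nat \<Rightarrow> simplicial_loop set" where
  "loops d = simplicial_lattice d \<times> {\<xi>. \<xi> permutes {1..d}}"

definition loop_path :: "nat \<Rightarrow> simplicial_loop \<Rightarrow> nat \<Rightarrow> point" where
  "loop_path d = (\<lambda>(x, \<xi>). \<lambda>k\<in>{0..d+1}.
     if k = 0 then x else x + gen d (d+1) + (\<Sum>j\<in>{1..k-1}. gen d (\<xi> j)))"

definition loop_edges :: "nat \<Rightarrow> simplicial_loop \<Rightarrow> point set set" where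
  "loop_edges d l = path_edges d (loop_path d l)"

lemma normal_vec_apply: "normal_vec d j = (if j \<in> {1..d+1} then 1 else 0)"
proof -
  have *: "(\<Sum>i\<in>A. h i) j = (\<Sum>i\<in>A. h i j)" if "finite A" for A and h :: "nat \<Rightarrow> point"
    using that by (induction A rule: finite_induct) auto
  show ?thesis
    by (simp add: normal_vec_def * unit_vec_def)
qed

lemma dot_normal_vec: "dot d x (normal_vec d) = (\<Sum>i\<in>{1..d+1}. x i)"
  by (simp add: dot_def normal_vec_apply)

lemma proj_apply:
  "proj d x j = x j - (\<Sum>i\<in>{1..d+1}. x i) / (real d + 1) * (if j \<in> {1..d+1} then 1 else 0)"
proof -
  have "(\<Sum>i\<in>{1..d+1}. normal_vec d i) = real d + 1"
    by (simp add: normal_vec_apply)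
  then show ?thesis
    by (simp add: proj_def dot_normal_vec) (simp add: normal_vec_apply)
qed

lemma gen_apply:
  assumes "i \<in> {1..d+1}"
  shows "gen d i j = (if j = i then 1 else 0) - (if j \<in> {1..d+1} then 1 / (real d + 1) else 0)"
proof -
  have "(\<Sum>k\<in>{1..d+1}. unit_vec i k) = 1"
    using assms by (simp add: unit_vec_def)
  then show ?thesis
    unfolding gen_def proj_apply by (simp add: unit_vec_def)
qed

lemma gen_inject:
  assumes "i \<in> {1..d+1}" "i' \<in> {1..d+1}" "gen d i = gen d i'"
  shows "i = i'"
proof (rule ccontr)
  assume "i \<noteq> i'"
  moreover have "gen d i i = gen d i' i" using assms(3) by simp
  ultimately show False using assms(1,2) by (simp add: gen_apply)
qed

lemma sum_gen: "(\<Sum>i\<in>{1..d+1}. gen d i) = 0"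
proof
  fix j
  have *: "(\<Sum>i\<in>A. h i) j = (\<Sum>i\<in>A. h i j)" if "finite A" for A and h :: "nat \<Rightarrow> point"
    using that by (induction A rule: finite_induct) auto
  have "(\<Sum>i\<in>{1..d+1}. gen d i j)
      = (\<Sum>i\<in>{1..d+1}. (if j = i then 1 else 0) - (if j \<in> {1..d+1} then 1 / (real d + 1) else 0))"
    by (rule sum.cong[OF refl], rule gen_apply)
  also have "\<dots> = 0"
    unfolding sum_subtractf by (auto simp: field_simps)
  finally show "(\<Sum>i\<in>{1..d+1}. gen d i) j = 0 j"
    by (simp add: * del: sum.cl_ivl_Suc)
qed

lemma lattice_add_gen:
  assumes "x \<in> simplicial_lattice d" "i \<in> {1..d+1}"
  shows "x + gen d i \<in> simplicial_lattice d"
proof -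
  obtain z where z: "z \<in> int_lattice d" "x = proj d z"
    using assms(1) by (auto simp: simplicial_lattice_def)
  have "x + gen d i = proj d (z + unit_vec i)"
    unfolding z gen_def
    by (auto simp: fun_eq_iff proj_apply sum.distrib add_divide_distrib algebra_simps)
  moreover have "z + unit_vec i \<in> int_lattice d"
    using z(1) assms(2) by (auto simp: int_lattice_def unit_vec_def)
  ultimately show ?thesis by (auto simp: simplicial_lattice_def)
qed

lemma loop_path_step:
  assumes "k \<in> {1..d+1}"
  shows "loop_path d (x, \<xi>) k
    = loop_path d (x, \<xi>) (k-1) + gen d (if k = 1 then d+1 else \<xi> (k-1))"
proof (cases "k = 1")
  case False
  then obtain m where m: "k = Suc (Suc m)"
    using assms by (metis atLeastAtMost_iff One_nat_def Suc_le_D old.nat.exhaust)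
  show ?thesis using assms unfolding m by (simp add: loop_path_def algebra_simps)
qed (simp add: loop_path_def)

lemma loop_path_rooted:
  assumes "l \<in> loops d"
  shows "loop_path d l \<in> rooted_loops d"
proof -
  obtain x \<xi> where l: "l = (x, \<xi>)" and x: "x \<in> simplicial_lattice d" and \<xi>: "\<xi> permutes {1..d}"
    using assms by (auto simp: loops_def)
  define \<zeta> where "\<zeta> k = (if k = 1 then d+1 else if k \<in> {2..d+1} then \<xi> (k-1) else k)" for k
  have range: "\<xi> k \<in> {1..d}" if "k \<in> {1..d}" for k
    using \<xi> that by (simp only: permutes_in_image)
  have rangez: "\<zeta> k \<in> {1..d}" if "k \<in> {2..d+1}" for k
  proof -
    have "k - 1 \<in> {1..d}" using that by auto
    then show ?thesis using range[of "k-1"] that by (simp add: \<zeta>_def)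
  qed
  have "inj_on \<zeta> {1..d+1}"
  proof (rule inj_onI)
    fix a b assume ab: "a \<in> {1..d+1}" "b \<in> {1..d+1}" "\<zeta> a = \<zeta> b"
    show "a = b"
    proof (cases "a = 1 \<or> b = 1")
      case True
      have one: "\<zeta> 1 = d + 1" by (simp add: \<zeta>_def)
      have "c = 1" if "c \<in> {1..d+1}" "\<zeta> c = d + 1" for c
        using rangez[of c] that by (cases "c = 1") auto
      then show ?thesis using True ab one by metis
    next
      case False
      then have "\<xi> (a-1) = \<xi> (b-1)" using ab by (auto simp: \<zeta>_def split: if_splits)
      then have "a - 1 = b - 1" using permutes_inj[OF \<xi>] by (auto dest: injD)
      then show ?thesis using ab by auto
    qed
  qed
  moreover have "\<zeta> ` {1..d+1} \<subseteq> {1..d+1}"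
  proof
    fix y assume "y \<in> \<zeta> ` {1..d+1}"
    then obtain k where k: "k \<in> {1..d+1}" "y = \<zeta> k" by auto
    show "y \<in> {1..d+1}"
      using rangez[of k] k by (cases "k = 1") (auto simp: \<zeta>_def)
  qed
  ultimately have "bij_betw \<zeta> {1..d+1} {1..d+1}"
    unfolding bij_betw_def by (metis endo_inj_surj finite_atLeastAtMost)
  then have perm: "\<zeta> permutes {1..d+1}"
    by (rule bij_imp_permutes) (auto simp: \<zeta>_def)
  have step: "loop_path d l k = loop_path d l (k-1) + gen d (\<zeta> k)" if "k \<in> {1..d+1}" for k
    using loop_path_step[OF that, of x \<xi>] that by (auto simp: l \<zeta>_def)
  have mem: "loop_path d l k \<in> simplicial_lattice d" if "k \<le> d+1" for k
    using that
  proof (induction k)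
    case 0 then show ?case using x by (simp add: l loop_path_def)
  next
    case (Suc k)
    then have "loop_path d l (Suc k) = loop_path d l k + gen d (\<zeta> (Suc k))"
      using step[of "Suc k"] by simp
    moreover have "\<zeta> (Suc k) \<in> {1..d+1}"
      using Suc.prems perm by (subst permutes_in_image) auto
    moreover have "loop_path d l k \<in> simplicial_lattice d" using Suc by simp
    ultimately show ?case by (metis lattice_add_gen)
  qed
  have "(\<Sum>j\<in>{1..d}. gen d (\<xi> j)) = (\<Sum>j\<in>{1..d}. gen d j)"
    using sum.permute[OF \<xi>, of "gen d"] by (simp add: comp_def)
  then have "gen d (d+1) + (\<Sum>j\<in>{1..d}. gen d (\<xi> j)) = 0"
    using sum_gen[of d] by (simp add: add.commute)
  then have closed: "loop_path d l (d+1) = loop_path d l 0"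
    by (simp add: l loop_path_def add.assoc)
  have "loop_path d l \<in> {0..d+1} \<rightarrow>\<^sub>E simplicial_lattice d"
    using mem by (auto simp: PiE_def extensional_def) (auto simp: l loop_path_def)
  then show ?thesis using perm step closed by (auto simp: rooted_loops_def)
qed

lemma reindex_0:
  assumes "s \<in> rooted_loops d"
  shows "reindex d 0 s = s"
proof
  fix k
  show "reindex d 0 s k = s k"
  proof (cases "k \<le> d")
    case False
    then show ?thesis using assms
      by (cases "k = d+1") (auto simp: reindex_def rooted_loops_def PiE_def extensional_def)
  qed (auto simp: reindex_def)
qed

lemma reindex_reindex: "reindex d i (reindex d j s) = reindex d ((i + j) mod (d+1)) s"
proof
  fix k
  have "(k + i) mod (d+1) \<le> d + 1"
    using mod_less_divisor[of "d+1" "k+i"] by linarith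
  moreover have "((k + i) mod (d+1) + j) mod (d+1) = (k + (i + j) mod (d+1)) mod (d+1)"
    unfolding mod_add_left_eq mod_add_right_eq by (simp only: add.assoc)
  ultimately show "reindex d i (reindex d j s) k = reindex d ((i + j) mod (d+1)) s k"
    by (auto simp: reindex_def)
qed

lemma unrooted_reindex:
  assumes "j \<le> d"
  shows "unrooted d (reindex d j s) = unrooted d s"
proof (rule set_eqI)
  fix t
  have lt: "m mod (d+1) \<le> d" for m
    using mod_less_divisor[of "d+1" m] by linarith
  show "t \<in> unrooted d (reindex d j s) \<longleftrightarrow> t \<in> unrooted d s"
  proof
    assume "t \<in> unrooted d (reindex d j s)"
    then show "t \<in> unrooted d s"
      using lt unfolding unrooted_def reindex_reindex by blast
  next
    assume "t \<in> unrooted d s"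
    then obtain i where i: "i \<le> d" "t = reindex d i s" by (auto simp: unrooted_def)
    have "((i + (d+1-j)) mod (d+1) + j) mod (d+1) = (i + (d+1-j) + j) mod (d+1)"
      by (rule mod_add_left_eq)
    also have "\<dots> = (i + (d+1)) mod (d+1)" using assms by simp
    also have "\<dots> = i" unfolding mod_add_self2 using i by simp
    finally have "t = reindex d ((i + (d+1-j)) mod (d+1)) (reindex d j s)"
      by (simp only: reindex_reindex i(2))
    then show "t \<in> unrooted d (reindex d j s)"
      using lt unfolding unrooted_def by blast
  qed
qed

lemma rooted_loop_normal_form:
  assumes s: "s \<in> rooted_loops d"
  shows "\<exists>l\<in>loops d. unrooted d (loop_path d l) = unrooted d s"
proof -
  obtain \<zeta> where \<zeta>: "\<zeta> permutes {1..d+1}"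
    and step: "\<And>k. k \<in> {1..d+1} \<Longrightarrow> s k = s (k-1) + gen d (\<zeta> k)"
    and closed: "s (d+1) = s 0" and mem: "\<And>k. k \<le> d+1 \<Longrightarrow> s k \<in> simplicial_lattice d"
    using s by (auto simp: rooted_loops_def PiE_def Pi_def)
  have "d+1 \<in> \<zeta> ` {1..d+1}" unfolding permutes_image[OF \<zeta>] by simp
  obtain j where j: "j \<le> d" "\<zeta> (j+1) = d+1"
  proof -
    obtain k where k: "k \<in> {1..d+1}" "\<zeta> k = d+1"
      using \<open>d+1 \<in> \<zeta> ` {1..d+1}\<close> by (metis imageE)
    then have "k - 1 \<le> d" "k - 1 + 1 = k" by auto
    then show thesis using that[of "k-1"] k by simp
  qed
  define \<xi> where "\<xi> k = (if k \<in> {1..d} then \<zeta> ((k+j) mod (d+1) + 1) else k)" for k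
  have lt: "m mod (d+1) \<le> d" for m
    using mod_less_divisor[of "d+1" m] by linarith
  have modinj: "a = b" if "a \<le> d" "b \<le> d" "(a+j) mod (d+1) = (b+j) mod (d+1)" for a b
  proof -
    have "(a + j + (d+1-j)) mod (d+1) = (b + j + (d+1-j)) mod (d+1)"
      using arg_cong[OF that(3), of "\<lambda>m. (m + (d+1-j)) mod (d+1)"] by (simp only: mod_add_left_eq)
    moreover have "a + j + (d+1-j) = a + (d+1)" "b + j + (d+1-j) = b + (d+1)" using j by auto
    ultimately have "a mod (d+1) = b mod (d+1)" by (simp only: mod_add_self2)
    then show ?thesis using that by simp
  qed
  have \<zeta>inj: "a = b" if "\<zeta> a = \<zeta> b" for a b
    using permutes_inj[OF \<zeta>] that by (auto dest: injD)
  have "inj_on \<xi> {1..d}"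
  proof (rule inj_onI)
    fix a b assume ab: "a \<in> {1..d}" "b \<in> {1..d}" "\<xi> a = \<xi> b"
    then have "\<zeta> ((a+j) mod (d+1) + 1) = \<zeta> ((b+j) mod (d+1) + 1)" by (simp only: \<xi>_def if_True)
    from \<zeta>inj[OF this] have "(a+j) mod (d+1) = (b+j) mod (d+1)" by (simp only: add_right_cancel)
    then show "a = b" using modinj[of a b] ab by (simp only: atLeastAtMost_iff)
  qed
  moreover have "\<xi> ` {1..d} \<subseteq> {1..d}"
  proof
    fix y assume "y \<in> \<xi> ` {1..d}"
    then obtain k where k: "k \<in> {1..d}" "y = \<zeta> ((k+j) mod (d+1) + 1)" by (auto simp: \<xi>_def)
    have "y \<in> {1..d+1}"
      unfolding k(2) permutes_in_image[OF \<zeta>] using lt[of "k+j"] by simp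
    moreover have "y \<noteq> d+1"
    proof
      assume "y = d+1"
      then have "(k+j) mod (d+1) + 1 = j + 1" using \<zeta>inj k j by metis
      then have "(k+j) mod (d+1) = (0+j) mod (d+1)" using j by simp
      then show False using modinj[of k 0] k by simp
    qed
    ultimately show "y \<in> {1..d}" by auto
  qed
  ultimately have "bij_betw \<xi> {1..d} {1..d}"
    unfolding bij_betw_def by (metis endo_inj_surj finite_atLeastAtMost)
  then have \<xi>: "\<xi> permutes {1..d}"
    by (rule bij_imp_permutes) (auto simp: \<xi>_def)
  have path: "loop_path d (s j, \<xi>) k = s ((k+j) mod (d+1))" if "k \<le> d+1" for k
    using that
  proof (induction k)
    case 0 then show ?case using j by (simp add: loop_path_def)
  next
    case (Suc k)
    define m where "m = (k+j) mod (d+1)"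
    have m: "m \<le> d" unfolding m_def by (rule lt)
    have "gen d (\<zeta> (m+1)) = gen d (if Suc k = 1 then d+1 else \<xi> (Suc k - 1))"
      using j Suc.prems by (auto simp: m_def \<xi>_def)
    then have "loop_path d (s j, \<xi>) (Suc k) = s m + gen d (\<zeta> (m+1))"
      using loop_path_step[of "Suc k" d "s j" \<xi>] Suc by (simp add: m_def)
    also have "\<dots> = s (m+1)" using step[of "m+1"] m by simp
    also have "\<dots> = s ((m+1) mod (d+1))"
      using m closed by (cases "m = d") auto
    also have "(m+1) mod (d+1) = (Suc k + j) mod (d+1)"
      unfolding m_def by (simp add: mod_Suc_eq)
    finally show ?case .
  qed
  have "loop_path d (s j, \<xi>) = reindex d j s"
  proof
    fix k
    show "loop_path d (s j, \<xi>) k = reindex d j s k"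
      using path[of k] by (cases "k \<le> d+1") (simp_all add: reindex_def loop_path_def)
  qed
  then have "unrooted d (loop_path d (s j, \<xi>)) = unrooted d s"
    using unrooted_reindex j by simp
  moreover have "(s j, \<xi>) \<in> loops d" using mem j \<xi> by (auto simp: loops_def)
  ultimately show ?thesis by blast
qed

lemma bij_betw_loops:
  "bij_betw (\<lambda>l. unrooted d (loop_path d l)) (loops d) (unrooted d ` rooted_loops d)"
  unfolding bij_betw_def
proof
  show "(\<lambda>l. unrooted d (loop_path d l)) ` loops d = unrooted d ` rooted_loops d"
  proof (intro equalityI subsetI)
    fix u assume "u \<in> unrooted d ` rooted_loops d"
    then obtain s where "s \<in> rooted_loops d" "u = unrooted d s" by blast
    then show "u \<in> (\<lambda>l. unrooted d (loop_path d l)) ` loops d"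
      using rooted_loop_normal_form[of s d] by force
  next
    fix u assume "u \<in> (\<lambda>l. unrooted d (loop_path d l)) ` loops d"
    then show "u \<in> unrooted d ` rooted_loops d" using loop_path_rooted by blast
  qed
  show "inj_on (\<lambda>l. unrooted d (loop_path d l)) (loops d)"
  proof (rule inj_onI)
    fix l l' assume L: "l \<in> loops d" "l' \<in> loops d"
      and eq: "unrooted d (loop_path d l) = unrooted d (loop_path d l')"
    obtain x \<xi> where l: "l = (x, \<xi>)" and \<xi>: "\<xi> permutes {1..d}"
      using L by (auto simp: loops_def)
    obtain x' \<xi>' where l': "l' = (x', \<xi>')" and \<xi>': "\<xi>' permutes {1..d}"
      using L by (auto simp: loops_def)
    define s where "s = loop_path d l"
    define s' where "s' = loop_path d l'"
    have "s = reindex d 0 s"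
      using reindex_0[OF loop_path_rooted[OF L(1)]] by (simp add: s_def)
    then have "s \<in> unrooted d s" unfolding unrooted_def by blast
    then have "s \<in> unrooted d s'" using eq by (simp add: s_def s'_def)
    then obtain j where j: "j \<le> d" "s = reindex d j s'" by (auto simp: unrooted_def)
    have closed': "s' (d+1) = s' 0"
      using loop_path_rooted[OF L(2)] by (simp add: s'_def rooted_loops_def)
    have s0: "s 0 = s' j" using j by (simp add: reindex_def)
    have "s 1 = s' ((1+j) mod (d+1))" using j by (simp add: reindex_def)
    also have "\<dots> = s' (j+1)" using j closed' by (cases "j = d") auto
    also have "\<dots> = s' j + gen d (if j = 0 then d+1 else \<xi>' j)"
      using loop_path_step[of "j+1" d x' \<xi>'] j by (simp add: s'_def l')
    finally have "s 1 = s' j + gen d (if j = 0 then d+1 else \<xi>' j)" .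
    moreover have "s 1 = s 0 + gen d (d+1)"
      using loop_path_step[of 1 d x \<xi>] by (simp add: s_def l)
    ultimately have geq: "gen d (d+1) = gen d (if j = 0 then d+1 else \<xi>' j)"
      using s0 by simp
    have "j = 0"
    proof (rule ccontr)
      assume "j \<noteq> 0"
      then have "\<xi>' j \<in> {1..d}" using j by (simp only: permutes_in_image[OF \<xi>']) simp
      then show False using geq gen_inject[of "d+1" d "\<xi>' j"] \<open>j \<noteq> 0\<close> by simp
    qed
    then have ss: "s = s'"
      using j reindex_0[OF loop_path_rooted[OF L(2)]] by (simp add: s'_def)
    have xx: "x = x'"
      using fun_cong[OF ss, of 0] by (simp add: s_def s'_def l l' loop_path_def)
    have "\<xi> k = \<xi>' k" for k
    proof (cases "k \<in> {1..d}")
      case True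
      have "s (k+1) = s k + gen d (\<xi> k)"
        using loop_path_step[of "k+1" d x \<xi>] True by (simp add: s_def l)
      moreover have "s' (k+1) = s' k + gen d (\<xi>' k)"
        using loop_path_step[of "k+1" d x' \<xi>'] True by (simp add: s'_def l')
      ultimately have "gen d (\<xi> k) = gen d (\<xi>' k)" using ss by simp
      moreover have "\<xi> k \<in> {1..d}" "\<xi>' k \<in> {1..d}"
        using True by (simp_all only: permutes_in_image[OF \<xi>] permutes_in_image[OF \<xi>'])
      ultimately show ?thesis using gen_inject[of "\<xi> k" d "\<xi>' k"] by simp
    qed (use \<xi> \<xi>' in \<open>simp add: permutes_not_in\<close>)
    then show "l = l'" using xx l l' by auto
  qed
qed


section \<open>The Kasteleyn hypermatrix and the Cayley hyperdeterminant\<close>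

definition hyperedge :: "nat \<Rightarrow> point set \<Rightarrow> simplicial_loop set" where
  "hyperedge d e = {l \<in> loops d. e \<in> loop_edges d l}"

definition loop_class :: "nat \<Rightarrow> point set \<Rightarrow> point set set \<Rightarrow> (nat \<Rightarrow> nat) \<Rightarrow> simplicial_loop set" where
  "loop_class d R T \<xi> =
     {l \<in> simplicial_lattice d \<times> {\<xi>}. \<exists>e\<in>T \<inter> region_edges d R. e \<in> loop_edges d l}"

text \<open>
  A tuple \<open>(s\<^sub>1, \<dots>, s\<^sub>m)\<close> is an extensional function on \<open>{1..m}\<close>; here \<open>m = d!\<close> and \<open>\<Xi>\<close> is the
  enumeration of \<open>S\<^sub>d\<close>.
\<close>

definition kasteleyn ::
  "nat \<Rightarrow> point set \<Rightarrow> point set set \<Rightarrow> (nat \<Rightarrow> nat \<Rightarrow> nat) \<Rightarrow> (nat \<Rightarrow> simplicial_loop) \<Rightarrow> complex" where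
  "kasteleyn d R T \<Xi> = (\<lambda>s\<in>(\<Pi>\<^sub>E i\<in>{1..fact d}. loop_class d R T (\<Xi> i)).
     if s ` {1..fact d} \<in> hyperedge d ` region_edges d R then 1 else 0)"

text \<open>
  The Cayley hyperdeterminant is used for even \<open>m\<close> only; \<open>m = d!\<close> is even as soon as \<open>d \<ge> 2\<close>.
\<close>

definition hyperdet :: "nat \<Rightarrow> nat \<Rightarrow> ((nat \<Rightarrow> nat) \<Rightarrow> complex) \<Rightarrow> complex" where
  "hyperdet m n A = (\<Sum>\<sigma>\<in>{2..m} \<rightarrow>\<^sub>E {p. p permutes {1..n}}.
     (\<Prod>i\<in>{2..m}. of_int (sign (\<sigma> i))) *
     (\<Prod>k\<in>{1..n}. A (\<lambda>i\<in>{1..m}. if i = 1 then k else \<sigma> i k)))"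

end

theory Submission
  imports Defs
begin

text \<open>
  A height function in \<open>\<Omega>(R, f)\<close> is recovered from its tiling by summing increments along a ray that leaves
  \<open>R\<close>. The nonzero terms of the hyperdeterminant are the perfect matchings of the hypergraph, that is, the
  tilings in \<open>\<Theta>(R, T)\<close>, so it remains to see that all of them have the same sign. Any two height
  functions in \<open>\<Omega>(R, f)\<close> are joined by flips of a local minimum to a local maximum, and a flip at \<open>x\<close> changes
  the \<open>i\<close>-th permutation by a conjugate of \<open>\<pi>\<^sub>i\<inverse> \<circ> \<pi>\<^sub>1\<close>, where \<open>\<pi>\<^sub>i\<close> sends the direction in which a loop of
  the \<open>i\<close>-th class enters \<open>x\<close> to the direction in which it leaves. All \<open>\<pi>\<^sub>i\<close> are \<open>(d+1)\<close>-cycles, so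
  this is an even permutation.
\<close>

section \<open>The simplicial lattice\<close>

text \<open>Flips connect \<open>\<Omega>\<close> because every step changes a height by 1 modulo
  d+1: two functions of \<open>\<Omega>\<close> differ by multiples of d+1, which is the amount of
  one flip, so a flip towards the other function never overshoots. A flip at \<open>x\<close>
  exchanges the d+1 tiling edges that enter \<open>x\<close> for the d+1 edges that leave it. The
  permutation of class \<open>i\<close> is read off relative to class 1. A class-1 loop that enters
  \<open>x\<close> in direction \<open>j\<close> now has its tiling edge in direction
  \<open>\<pi> 1 j\<close>, and the class-\<open>i\<close> loop through that edge enters
  \<open>x\<close> in direction \<open>inv (\<pi> i) (\<pi> 1 j)\<close>. This is the origin of the
  composite; the two signs (-1)^d cancel in it, so the argument is uniform in the parity of d.
  Connectedness of the complement serves the existence of height functions: a ray may leave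
  \<open>R\<close> and enter it again, so the vanishing of the correction outside \<open>R\<close>
  is not automatic.\<close>

locale simplicial =
  fixes d :: nat
  assumes d_ge_2: "2 \<le> d"
begin

abbreviation "L \<equiv> simplicial_lattice d"
abbreviation "I \<equiv> {1..d+1}"
abbreviation "g \<equiv> gen d"

lemma lattice_diff:
  assumes "x \<in> L" "y \<in> L"
  shows "x - y \<in> L"
proof -
  obtain z w where zw: "z \<in> int_lattice d" "x = proj d z" "w \<in> int_lattice d" "y = proj d w"
    using assms by (auto simp: simplicial_lattice_def)
  have "x - y = proj d (z - w)"
    unfolding zw by (auto simp: fun_eq_iff proj_apply sum_subtractf diff_divide_distrib algebra_simps)
  moreover have "z - w \<in> int_lattice d"
    using zw by (auto simp: int_lattice_def)
  ultimately show ?thesis by (auto simp: simplicial_lattice_def)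
qed

lemma zero_in_lattice: "0 \<in> L"
proof -
  have "proj d 0 = 0" by (auto simp: fun_eq_iff proj_apply)
  moreover have "0 \<in> int_lattice d" by (auto simp: int_lattice_def)
  ultimately show ?thesis unfolding simplicial_lattice_def by (metis imageI)
qed

lemma gen_in_lattice: "i \<in> I \<Longrightarrow> g i \<in> L"
  using lattice_add_gen[OF zero_in_lattice, of i] by simp

lemma lattice_diff_gen: "x \<in> L \<Longrightarrow> i \<in> I \<Longrightarrow> x - g i \<in> L"
  by (rule lattice_diff) (auto intro: gen_in_lattice)

text \<open>For d >= 2 there is a third coordinate, and there both generators equal -1/(d+1). For d
  = 1 the two generators are opposite; excluding this gives every edge a single starting point and a
  single direction.\<close>

lemma gen_add_gen_neq_0:
  assumes "i \<in> I" "j \<in> I"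
  shows "g i + g j \<noteq> 0"
proof
  assume *: "g i + g j = 0"
  have "\<not> I \<subseteq> {i, j}"
  proof
    assume "I \<subseteq> {i, j}"
    then have "card I \<le> card {i, j}" by (rule card_mono[rotated]) simp
    also have "\<dots> \<le> 2" by (simp add: card_insert_if)
    finally show False using d_ge_2 by simp
  qed
  then obtain k where k: "k \<in> I" "k \<noteq> i" "k \<noteq> j" by blast
  have "(g i + g j) k = 0" using * by simp
  then show False using k assms by (simp add: gen_apply)
qed

lemma gen_neq_0: "i \<in> I \<Longrightarrow> g i \<noteq> 0"
  using gen_add_gen_neq_0[of i i] by auto

definition edge :: "point \<Rightarrow> nat \<Rightarrow> point set" where
  "edge x i = {x, x + g i}"

lemma edge_inject:
  assumes "i \<in> I" "j \<in> I"
  shows "edge x i = edge y j \<longleftrightarrow> x = y \<and> i = j"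
proof
  assume "edge x i = edge y j"
  then consider "x = y" "x + g i = y + g j" | "x = y + g j" "x + g i = y"
    unfolding edge_def doubleton_eq_iff by blast
  then show "x = y \<and> i = j"
  proof cases
    case 1
    then show ?thesis using gen_inject[OF assms] by simp
  next
    case 2
    then have "g i + g j = 0" by (simp add: algebra_simps)
    then show ?thesis using gen_add_gen_neq_0[OF assms] by simp
  qed
qed simp

lemma lattice_edges_eq: "lattice_edges d = {edge x i | x i. x \<in> L \<and> i \<in> I}"
  by (simp add: lattice_edges_def edge_def)

lemma edge_in_lattice_edges: "x \<in> L \<Longrightarrow> i \<in> I \<Longrightarrow> edge x i \<in> lattice_edges d"
  unfolding lattice_edges_eq by blast

lemma lattice_edgeE:
  assumes "e \<in> lattice_edges d"
  obtains x i where "x \<in> L" "i \<in> I" "e = edge x i"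
  using assms unfolding lattice_edges_eq by blast

subsection \<open>Simplicial loops\<close>

definition walk :: "point \<Rightarrow> (nat \<Rightarrow> nat) \<Rightarrow> nat \<Rightarrow> point" where
  "walk x \<zeta> k = x + (\<Sum>j\<in>{1..k}. g (\<zeta> j))"

definition cycle_edges :: "point \<Rightarrow> (nat \<Rightarrow> nat) \<Rightarrow> point set set" where
  "cycle_edges x \<zeta> = (\<lambda>k. edge (walk x \<zeta> (k - 1)) (\<zeta> k)) ` I"

text \<open>The vertex of the loop based at the origin from which direction \<open>i\<close> is
  taken. Steps are numbered from 1 and \<open>inv \<zeta> i\<close> is the number of the step,
  whence the subtraction.\<close>

definition offset :: "(nat \<Rightarrow> nat) \<Rightarrow> nat \<Rightarrow> point" where
  "offset \<zeta> i = walk 0 \<zeta> (inv \<zeta> i - 1)"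

lemma walk_0 [simp]: "walk x \<zeta> 0 = x"
  by (simp add: walk_def)

lemma walk_Suc: "walk x \<zeta> (Suc k) = walk x \<zeta> k + g (\<zeta> (Suc k))"
  by (simp add: walk_def add.assoc)

lemma walk_step: "k \<in> I \<Longrightarrow> walk x \<zeta> k = walk x \<zeta> (k - 1) + g (\<zeta> k)"
  using walk_Suc[of x \<zeta> "k - 1"] by simp

lemma walk_shift: "walk x \<zeta> k = x + walk 0 \<zeta> k"
  by (simp add: walk_def)

lemma perm_I: "\<zeta> permutes I \<Longrightarrow> k \<in> I \<Longrightarrow> \<zeta> k \<in> I"
  by (simp only: permutes_in_image)

lemma walk_in_lattice:
  assumes "x \<in> L" "\<zeta> permutes I" "k \<le> d + 1"
  shows "walk x \<zeta> k \<in> L"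
  using assms(3)
proof (induction k)
  case (Suc k)
  have "\<zeta> (Suc k) \<in> I" using Suc.prems by (intro perm_I[OF assms(2)]) simp
  then show ?case
    unfolding walk_Suc using Suc by (intro lattice_add_gen) auto
qed (simp add: assms)

lemma walk_closed:
  assumes "\<zeta> permutes I"
  shows "walk x \<zeta> (d + 1) = x"
proof -
  have "(\<Sum>j\<in>I. g (\<zeta> j)) = (\<Sum>j\<in>I. g j)"
    using sum.permute[OF assms, of g] by (simp add: comp_def)
  then show ?thesis by (simp only: walk_def sum_gen) simp
qed

lemma offset_apply:
  assumes "\<zeta> permutes I"
  shows "offset \<zeta> (\<zeta> k) = walk 0 \<zeta> (k - 1)"
  by (simp add: offset_def permutes_inverses(2)[OF assms])

lemma offset_in_lattice:
  assumes "\<zeta> permutes I" "i \<in> I"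
  shows "offset \<zeta> i \<in> L"
proof -
  have "inv \<zeta> i \<in> I" using perm_I[OF permutes_inv[OF assms(1)] assms(2)] .
  then have "inv \<zeta> i - 1 \<le> d + 1" unfolding atLeastAtMost_iff by linarith
  then show ?thesis
    unfolding offset_def by (rule walk_in_lattice[OF zero_in_lattice assms(1)])
qed

text \<open>A loop takes each direction exactly once, so an edge of direction \<open>i\<close> can
  occur on it in one position only. Membership becomes an equation that can be solved for the base
  point \<open>y\<close>.\<close>

lemma edge_in_cycle_edges:
  assumes "\<zeta> permutes I" "i \<in> I"
  shows "edge x i \<in> cycle_edges y \<zeta> \<longleftrightarrow> x = y + offset \<zeta> i"
proof
  assume "edge x i \<in> cycle_edges y \<zeta>"
  then obtain k where k: "k \<in> I" "edge x i = edge (walk y \<zeta> (k - 1)) (\<zeta> k)"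
    unfolding cycle_edges_def by blast
  then have "x = walk y \<zeta> (k - 1)" "i = \<zeta> k"
    using edge_inject[OF assms(2) perm_I[OF assms(1) k(1)]] by blast+
  then show "x = y + offset \<zeta> i"
    using walk_shift[of y \<zeta> "k - 1"] by (simp add: offset_apply[OF assms(1)])
next
  assume x: "x = y + offset \<zeta> i"
  have "inv \<zeta> i \<in> I" using perm_I[OF permutes_inv[OF assms(1)] assms(2)] .
  moreover have "\<zeta> (inv \<zeta> i) = i" using permutes_inverses(1)[OF assms(1)] .
  moreover have "x = walk y \<zeta> (inv \<zeta> i - 1)"
    unfolding x offset_def by (rule walk_shift[symmetric])
  ultimately have "edge x i = edge (walk y \<zeta> (inv \<zeta> i - 1)) (\<zeta> (inv \<zeta> i))" by metis
  then show "edge x i \<in> cycle_edges y \<zeta>"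
    unfolding cycle_edges_def using \<open>inv \<zeta> i \<in> I\<close> by (rule image_eqI)
qed

lemma walk_rooted_loop:
  assumes "x \<in> L" "\<zeta> permutes I"
  shows "restrict (walk x \<zeta>) {0..d+1} \<in> rooted_loops d"
    and "path_edges d (restrict (walk x \<zeta>) {0..d+1}) = cycle_edges x \<zeta>"
proof -
  show "restrict (walk x \<zeta>) {0..d+1} \<in> rooted_loops d"
    unfolding rooted_loops_def
  proof (intro CollectI conjI exI[of _ \<zeta>] ballI)
    show "restrict (walk x \<zeta>) {0..d + 1} \<in> {0..d + 1} \<rightarrow>\<^sub>E L"
      using walk_in_lattice[OF assms] by (intro restrict_PiE_iff[THEN iffD2]) simp
    show "restrict (walk x \<zeta>) {0..d + 1} (d + 1) = restrict (walk x \<zeta>) {0..d + 1} 0"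
      using walk_closed[OF assms(2), of x] by simp
    show "\<zeta> permutes I" by fact
    fix k assume "k \<in> I"
    then show "restrict (walk x \<zeta>) {0..d + 1} k = restrict (walk x \<zeta>) {0..d + 1} (k - 1) + g (\<zeta> k)"
      using walk_step[of k x \<zeta>] by auto
  qed
  show "path_edges d (restrict (walk x \<zeta>) {0..d+1}) = cycle_edges x \<zeta>"
    unfolding path_edges_def cycle_edges_def
  proof (rule image_cong[OF refl])
    fix k assume "k \<in> I"
    then show "{restrict (walk x \<zeta>) {0..d + 1} (k - 1), restrict (walk x \<zeta>) {0..d + 1} k}
      = edge (walk x \<zeta> (k - 1)) (\<zeta> k)"
      using walk_step[of k x \<zeta>] by (auto simp: edge_def)
  qed
qed

lemma rooted_loop_is_walk:
  assumes "s \<in> rooted_loops d"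
  obtains \<zeta> where "\<zeta> permutes I" "s 0 \<in> L" "s = restrict (walk (s 0) \<zeta>) {0..d+1}"
proof -
  obtain \<zeta> where \<zeta>: "\<zeta> permutes I"
    and step: "\<And>k. k \<in> I \<Longrightarrow> s k = s (k-1) + g (\<zeta> k)"
    and mem: "s \<in> {0..d+1} \<rightarrow>\<^sub>E L"
    using assms unfolding rooted_loops_def by blast
  define x where "x = s 0"
  have "s k = walk x \<zeta> k" if "k \<le> d + 1" for k
    using that
  proof (induction k)
    case (Suc k)
    then have "s (Suc k) = s k + g (\<zeta> (Suc k))" using step[of "Suc k"] by simp
    then show ?case using Suc by (simp add: walk_Suc)
  qed (simp add: x_def)
  then have "s = restrict (walk x \<zeta>) {0..d+1}"
    using mem by (auto simp: fun_eq_iff restrict_def PiE_iff extensional_def)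
  moreover have "s 0 \<in> L" using mem by auto
  ultimately show ?thesis using that[OF \<zeta>] by (simp only: x_def)
qed

lemma path_edges_reindex_subset:
  assumes "s (d + 1) = s 0"
  shows "path_edges d (reindex d j s) \<subseteq> path_edges d s"
proof
  fix e assume "e \<in> path_edges d (reindex d j s)"
  then obtain k where k: "k \<in> I" "e = {reindex d j s (k - 1), reindex d j s k}"
    unfolding path_edges_def by blast
  define m where "m = (k - 1 + j) mod (d + 1)"
  have m: "m \<le> d" unfolding m_def using mod_less_divisor[of "d+1" "k - 1 + j"] by linarith
  \<comment> \<open>Step \<open>k\<close> of the reindexed path is step \<open>m + 1\<close> of
    \<open>s\<close>; for \<open>m = d\<close> the index wraps to 0, where closedness replaces
    \<open>s 0\<close> by \<open>s (d + 1)\<close>.\<close>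
  have "(m + 1) mod (d + 1) = (k + j) mod (d + 1)"
    unfolding m_def using k(1) by (simp add: mod_Suc_eq)
  then have "s ((k + j) mod (d + 1)) = s (m + 1)"
    using m assms by (cases "m = d") (auto simp: mod_less)
  moreover have "reindex d j s k = s ((k + j) mod (d + 1))" "reindex d j s (k - 1) = s m"
    using k(1) by (auto simp: reindex_def m_def)
  ultimately have "e = {s (m + 1 - 1), s (m + 1)}" using k(2) by simp
  then show "e \<in> path_edges d s"
    unfolding path_edges_def by (rule image_eqI) (use m in simp)
qed

lemma path_edges_unrooted:
  assumes "s \<in> rooted_loops d" "t \<in> rooted_loops d" "unrooted d s = unrooted d t"
  shows "path_edges d s = path_edges d t"
proof -
  have *: "path_edges d s \<subseteq> path_edges d t"
    if st: "s \<in> rooted_loops d" "t \<in> rooted_loops d" "unrooted d s = unrooted d t" for s t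
  proof -
    have "s \<in> unrooted d s"
      using reindex_0[OF st(1)] unfolding unrooted_def by force
    then obtain j where "s = reindex d j t"
      using st(3) unfolding unrooted_def by blast
    moreover have "t (d + 1) = t 0" using st(2) unfolding rooted_loops_def by blast
    ultimately show ?thesis using path_edges_reindex_subset by metis
  qed
  show ?thesis using *[OF assms] *[OF assms(2,1)] assms(3) by auto
qed

text \<open>Prefixing the fixed first direction d+1 turns a permutation of the first d directions
  into one of all d+1 directions, so that normalised loops become special closed walks.\<close>

definition cyclic :: "(nat \<Rightarrow> nat) \<Rightarrow> nat \<Rightarrow> nat" where
  "cyclic \<xi> k = (if k = 1 then d + 1 else if k \<in> I then \<xi> (k - 1) else k)"

lemma
  assumes "\<xi> permutes {1..d}"
  shows cyclic_permutes: "cyclic \<xi> permutes I"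
    and loop_edges_eq: "loop_edges d (y, \<xi>) = cycle_edges y (cyclic \<xi>)"
proof -
  \<comment> \<open>Rootedness already supplies some permutation for the loop at the origin.
    Comparing increments step by step identifies it with \<open>cyclic \<xi>\<close>, and
    translation handles every other base point.\<close>
  have "(0, \<xi>) \<in> loops d" using assms zero_in_lattice by (simp add: loops_def)
  then obtain \<zeta> where \<zeta>: "\<zeta> permutes I"
    and eq: "loop_path d (0, \<xi>) = restrict (walk (loop_path d (0, \<xi>) 0) \<zeta>) {0..d+1}"
    using rooted_loop_is_walk[OF loop_path_rooted] by blast
  have eq: "loop_path d (0, \<xi>) = restrict (walk 0 \<zeta>) {0..d+1}"
    using eq by (simp add: loop_path_def)
  have "\<zeta> k = cyclic \<xi> k" for k
  proof (cases "k \<in> I")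
    case True
    define i where "i = (if k = 1 then d+1 else \<xi> (k-1))"
    have i: "i \<in> I"
    proof (cases "k = 1")
      case False
      then have "k - 1 \<in> {1..d}" using True by auto
      then have "\<xi> (k - 1) \<in> {1..d}" by (simp only: permutes_in_image[OF assms])
      then show ?thesis using False by (simp add: i_def)
    qed (simp add: i_def)
    have "restrict (walk 0 \<zeta>) {0..d+1} k = restrict (walk 0 \<zeta>) {0..d+1} (k - 1) + g i"
      unfolding eq[symmetric] i_def by (rule loop_path_step[OF True])
    moreover have "k - 1 \<in> {0..d+1}" "k \<in> {0..d+1}" using True by auto
    ultimately have "walk 0 \<zeta> k = walk 0 \<zeta> (k - 1) + g i" by (simp only: restrict_apply if_True)
    then have "g (\<zeta> k) = g i"
      using walk_step[OF True, of 0 \<zeta>] by simp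
    then have "\<zeta> k = i" using gen_inject[OF perm_I[OF \<zeta> True] i] by simp
    then show ?thesis using True by (simp add: cyclic_def i_def)
  next
    case False
    then show ?thesis using permutes_not_in[OF \<zeta> False] by (auto simp: cyclic_def)
  qed
  then have \<zeta>_eq: "\<zeta> = cyclic \<xi>" by auto
  show "cyclic \<xi> permutes I" using \<zeta> \<zeta>_eq by simp
  have "loop_path d (y, \<xi>) k = y + loop_path d (0, \<xi>) k" if "k \<le> d + 1" for k
    using that by (auto simp: loop_path_def algebra_simps)
  then have path: "loop_path d (y, \<xi>) k = walk y (cyclic \<xi>) k" if "k \<le> d + 1" for k
    using that walk_shift[of y \<zeta> k] eq by (simp add: \<zeta>_eq)
  show "loop_edges d (y, \<xi>) = cycle_edges y (cyclic \<xi>)"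
    unfolding loop_edges_def path_edges_def cycle_edges_def
  proof (rule image_cong[OF refl])
    fix k assume k: "k \<in> I"
    then have "loop_path d (y, \<xi>) (k - 1) = walk y (cyclic \<xi>) (k - 1)"
      "loop_path d (y, \<xi>) k = walk y (cyclic \<xi>) k"
      by (auto intro: path)
    then show "{loop_path d (y, \<xi>) (k - 1), loop_path d (y, \<xi>) k}
        = edge (walk y (cyclic \<xi>) (k - 1)) (cyclic \<xi> k)"
      using walk_step[OF k] by (simp add: edge_def)
  qed
qed

text \<open>The first direction of \<open>\<zeta>\<close> is arbitrary; rotating the loop until it
  starts with direction d+1 keeps its edges. Thus the tiling condition on normalised loops applies
  to every closed walk of this kind.\<close>

lemma cycle_edges_eq_loop_edges:
  assumes "x \<in> L" "\<zeta> permutes I"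
  shows "\<exists>l\<in>loops d. loop_edges d l = cycle_edges x \<zeta>"
proof -
  define s where "s = restrict (walk x \<zeta>) {0..d+1}"
  have s: "s \<in> rooted_loops d" "path_edges d s = cycle_edges x \<zeta>"
    using walk_rooted_loop[OF assms] by (auto simp: s_def)
  obtain l where l: "l \<in> loops d" "unrooted d (loop_path d l) = unrooted d s"
    using rooted_loop_normal_form[OF s(1)] by blast
  then have "loop_edges d l = cycle_edges x \<zeta>"
    unfolding loop_edges_def s(2)[symmetric]
    by (intro path_edges_unrooted loop_path_rooted s(1))
  then show ?thesis using l by blast
qed

lemma path_edges_eq_loop_edges:
  assumes "s \<in> rooted_loops d"
  shows "\<exists>l\<in>loops d. loop_edges d l = path_edges d s"
proof -
  obtain \<zeta> where "\<zeta> permutes I" "s 0 \<in> L" "s = restrict (walk (s 0) \<zeta>) {0..d+1}"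
    using rooted_loop_is_walk[OF assms] .
  then show ?thesis
    using cycle_edges_eq_loop_edges walk_rooted_loop(2) by metis
qed

section \<open>The loop of a prescribed class through an edge\<close>

definition loop_at :: "(nat \<Rightarrow> nat) \<Rightarrow> point set \<Rightarrow> simplicial_loop" where
  "loop_at \<xi> e = (THE l. l \<in> loops d \<and> snd l = \<xi> \<and> e \<in> loop_edges d l)"

lemma loop_at_edge:
  assumes "\<xi> permutes {1..d}" "x \<in> L" "i \<in> I"
  shows "loop_at \<xi> (edge x i) = (x - offset (cyclic \<xi>) i, \<xi>)"
    and "l \<in> loops d \<Longrightarrow> snd l = \<xi> \<Longrightarrow>
      edge x i \<in> loop_edges d l \<longleftrightarrow> l = (x - offset (cyclic \<xi>) i, \<xi>)"
    and "(x - offset (cyclic \<xi>) i, \<xi>) \<in> loops d"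
proof -
  note c = cyclic_permutes[OF assms(1)]
  show mem: "(x - offset (cyclic \<xi>) i, \<xi>) \<in> loops d"
    using assms offset_in_lattice[OF c assms(3)] by (auto simp: loops_def intro: lattice_diff)
  show iff: "edge x i \<in> loop_edges d l \<longleftrightarrow> l = (x - offset (cyclic \<xi>) i, \<xi>)"
    if "l \<in> loops d" "snd l = \<xi>" for l
    using that edge_in_cycle_edges[OF c assms(3), of x "fst l"] loop_edges_eq[OF assms(1), of "fst l"]
    by (cases l) (auto simp: algebra_simps)
  show "loop_at \<xi> (edge x i) = (x - offset (cyclic \<xi>) i, \<xi>)"
    unfolding loop_at_def by (rule the_equality) (use iff mem in auto)
qed

lemma
  assumes "\<xi> permutes {1..d}" "e \<in> lattice_edges d"
  shows loop_at_in_loops: "loop_at \<xi> e \<in> loops d"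
    and snd_loop_at: "snd (loop_at \<xi> e) = \<xi>"
    and in_loop_edges_iff: "l \<in> loops d \<Longrightarrow> snd l = \<xi> \<Longrightarrow> e \<in> loop_edges d l \<longleftrightarrow> l = loop_at \<xi> e"
proof -
  obtain x i where x: "x \<in> L" "i \<in> I" "e = edge x i" using lattice_edgeE[OF assms(2)] .
  note * = loop_at_edge[OF assms(1) x(1,2), folded x(3)]
  show "loop_at \<xi> e \<in> loops d" "snd (loop_at \<xi> e) = \<xi>" using *(1,3) by simp_all
  show "e \<in> loop_edges d l \<longleftrightarrow> l = loop_at \<xi> e" if "l \<in> loops d" "snd l = \<xi>"
    using *(1) *(2)[OF that] by simp
qed

lemma in_loop_edges_loop_at:
  assumes "\<xi> permutes {1..d}" "e \<in> lattice_edges d"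
  shows "e \<in> loop_edges d (loop_at \<xi> e)"
  using in_loop_edges_iff[OF assms loop_at_in_loops[OF assms] snd_loop_at[OF assms]] by simp

lemma tilings_iff:
  "Y \<in> tilings d \<longleftrightarrow> Y \<subseteq> lattice_edges d \<and> (\<forall>l\<in>loops d. card (Y \<inter> loop_edges d l) = 1)"
proof -
  have "(\<forall>s\<in>rooted_loops d. card (Y \<inter> path_edges d s) = 1)
      \<longleftrightarrow> (\<forall>l\<in>loops d. card (Y \<inter> loop_edges d l) = 1)"
    using path_edges_eq_loop_edges loop_path_rooted unfolding loop_edges_def by metis
  then show ?thesis unfolding tilings_def by blast
qed

lemma tilings_cycle:
  assumes "Y \<in> tilings d" "x \<in> L" "\<zeta> permutes I"
  shows "card (Y \<inter> cycle_edges x \<zeta>) = 1"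
  using assms cycle_edges_eq_loop_edges[OF assms(2,3)] unfolding tilings_iff by metis

section \<open>Injectivity of the map from edges to sets of loops\<close>

lemma ex_perm_first_two:
  assumes "i \<in> I" "j \<in> I" "i \<noteq> j"
  obtains \<zeta> where "\<zeta> permutes I" "\<zeta> 1 = i" "\<zeta> 2 = j"
proof -
  define \<tau> where "\<tau> = transpose 1 i"
  \<comment> \<open>\<open>\<tau>\<close> puts \<open>i\<close> at position 1. As
    \<open>\<tau>\<close> is an involution, sending position 2 to \<open>\<tau> j\<close> first
    gives \<open>j\<close> there, and position 1 is untouched because \<open>\<tau> j\<close> is not
    1.\<close>
  define \<zeta> where "\<zeta> = \<tau> \<circ> transpose 2 (\<tau> j)"
  have \<tau>: "\<tau> permutes I" unfolding \<tau>_def using assms(1) by (intro permutes_swap_id) auto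
  have "\<zeta> permutes I"
    unfolding \<zeta>_def using perm_I[OF \<tau> assms(2)] d_ge_2
    by (intro permutes_compose[OF _ \<tau>] permutes_swap_id) auto
  moreover have "\<tau> j \<noteq> 1" using assms(3) by (auto simp: \<tau>_def transpose_def)
  then have "\<zeta> 1 = i" by (simp add: \<zeta>_def \<tau>_def transpose_def)
  moreover have "\<zeta> 2 = j" by (simp add: \<zeta>_def \<tau>_def)
  ultimately show ?thesis by (rule that)
qed

text \<open>Some loop traverses \<open>edge x i\<close> and then \<open>edge (x + g i) j\<close>. Hence two edges with the same loops
  but different directions would each follow the other, against \<open>g i + g j \<noteq> 0\<close>.\<close>

lemma hyperedge_inject:
  assumes e: "e \<in> lattice_edges d" "e' \<in> lattice_edges d" and eq: "hyperedge d e = hyperedge d e'"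
  shows "e = e'"
proof -
  obtain x i where x: "x \<in> L" "i \<in> I" "e = edge x i" using lattice_edgeE[OF e(1)] .
  obtain y j where y: "y \<in> L" "j \<in> I" "e' = edge y j" using lattice_edgeE[OF e(2)] .
  have transfer: "e \<in> cycle_edges z \<zeta> \<longleftrightarrow> e' \<in> cycle_edges z \<zeta>" if "z \<in> L" "\<zeta> permutes I" for z \<zeta>
    using cycle_edges_eq_loop_edges[OF that] eq unfolding hyperedge_def by blast
  have follow: "y = x + g i" if xy: "x \<in> L" "i \<in> I" "y \<in> L" "j \<in> I" "i \<noteq> j"
    "\<And>z \<zeta>. z \<in> L \<Longrightarrow> \<zeta> permutes I \<Longrightarrow> edge x i \<in> cycle_edges z \<zeta> \<longleftrightarrow> edge y j \<in> cycle_edges z \<zeta>"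
    for x i y j
  proof -
    obtain \<zeta> where \<zeta>: "\<zeta> permutes I" and \<zeta>1: "\<zeta> 1 = i" and \<zeta>2: "\<zeta> 2 = j"
      using ex_perm_first_two[OF xy(2,4,5)] .
    have "offset \<zeta> i = 0" using offset_apply[OF \<zeta>, of 1] \<zeta>1 by simp
    then have "edge x i \<in> cycle_edges x \<zeta>"
      using edge_in_cycle_edges[OF \<zeta> xy(2)] by simp
    then have "edge y j \<in> cycle_edges x \<zeta>" using xy(6)[OF xy(1) \<zeta>] by simp
    then have "y = x + offset \<zeta> j" using edge_in_cycle_edges[OF \<zeta> xy(4)] by simp
    moreover have "offset \<zeta> j = g i"
      using offset_apply[OF \<zeta>, of 2] \<zeta>1 \<zeta>2 walk_Suc[of 0 \<zeta> 0] by simp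
    ultimately show ?thesis by simp
  qed
  show ?thesis
  proof (cases "i = j")
    case True
    \<comment> \<open>For a common direction any one loop decides, since its base point determines
      the starting point of its edge in that direction.\<close>
    have id: "id permutes I" by (rule permutes_id)
    have "edge x i \<in> cycle_edges (x - offset id i) id"
      using edge_in_cycle_edges[OF id x(2)] by simp
    then have "edge y i \<in> cycle_edges (x - offset id i) id"
      using transfer[OF lattice_diff[OF x(1) offset_in_lattice[OF id x(2)]] id] x y True by simp
    then have "y = x" using edge_in_cycle_edges[OF id x(2)] by simp
    then show ?thesis using x y True by simp
  next
    case False
    have "y = x + g i" using follow[of x i y j] x y False transfer by blast
    moreover have "x = y + g j" using follow[of y j x i] x y False transfer by blast
    ultimately have "g i + g j = 0" by (simp add: algebra_simps)
    then show ?thesis using gen_add_gen_neq_0[OF x(2) y(2)] by simp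
  qed
qed

section \<open>Consecutive directions on a loop\<close>

definition rotate_idx :: "nat \<Rightarrow> nat" where
  "rotate_idx k = (if k \<in> I then (if k = d + 1 then 1 else k + 1) else k)"

text \<open>Sends a direction in \<open>I\<close> to the one that the closed walk takes next,
  cyclically. As a conjugate of the rotation of step numbers it is a (d+1)-cycle on
  \<open>I\<close>.\<close>

definition succ_dir :: "(nat \<Rightarrow> nat) \<Rightarrow> nat \<Rightarrow> nat" where
  "succ_dir \<zeta> = \<zeta> \<circ> rotate_idx \<circ> inv \<zeta>"

lemma rotate_idx_permutes: "rotate_idx permutes I"
proof (rule bij_imp_permutes)
  have "inj_on rotate_idx I" by (auto simp: inj_on_def rotate_idx_def split: if_splits)
  moreover have "rotate_idx ` I \<subseteq> I" by (auto simp: rotate_idx_def)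
  ultimately show "bij_betw rotate_idx I I"
    unfolding bij_betw_def by (metis endo_inj_surj finite_atLeastAtMost)
qed (auto simp: rotate_idx_def)

lemma succ_dir_permutes: "\<zeta> permutes I \<Longrightarrow> succ_dir \<zeta> permutes I"
  unfolding succ_dir_def by (intro permutes_compose permutes_inv rotate_idx_permutes)

lemma permutation_I: "\<zeta> permutes I \<Longrightarrow> permutation \<zeta>"
  by (rule permutes_imp_permutation) auto

text \<open>Conjugation preserves the sign. Only its independence of \<open>\<zeta>\<close> is
  wanted, so the value (-1)^d is left unevaluated.\<close>

lemma sign_succ_dir:
  assumes "\<zeta> permutes I"
  shows "sign (succ_dir \<zeta>) = sign rotate_idx"
proof -
  note p = permutation_I[OF assms] permutation_I[OF rotate_idx_permutes]
    permutation_I[OF permutes_inv[OF assms]]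
  have "sign (succ_dir \<zeta>) = sign \<zeta> * sign rotate_idx * sign \<zeta>"
    unfolding succ_dir_def
    by (simp add: sign_compose p permutation_compose sign_inverse)
  then show ?thesis by (metis mult.commute sign_left_idempotent)
qed

lemma offset_succ_dir:
  assumes "\<zeta> permutes I" "i \<in> I"
  shows "offset \<zeta> (succ_dir \<zeta> i) = offset \<zeta> i + g i"
proof -
  define k where "k = inv \<zeta> i"
  have k: "k \<in> I" "\<zeta> k = i"
    using perm_I[OF permutes_inv[OF assms(1)] assms(2)] permutes_inverses(1)[OF assms(1)]
    by (auto simp: k_def)
  have "offset \<zeta> (succ_dir \<zeta> i) = walk 0 \<zeta> (rotate_idx k - 1)"
    unfolding succ_dir_def comp_def k_def[symmetric] by (rule offset_apply[OF assms(1)])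
  \<comment> \<open>For \<open>k = d + 1\<close> the rotation returns to step 1, which starts at the
    origin; closedness makes this the end of step d+1.\<close>
  also have "\<dots> = walk 0 \<zeta> k"
    using k(1) walk_closed[OF assms(1), of 0] by (auto simp: rotate_idx_def)
  also have "\<dots> = offset \<zeta> i + g i"
    using walk_step[OF k(1), of 0 \<zeta>] offset_apply[OF assms(1), of k] k(2) by simp
  finally show ?thesis .
qed

text \<open>The two edges are consecutive on one loop: it enters \<open>x\<close> through the second
  and leaves \<open>x\<close> through the first.\<close>

lemma loop_at_succ:
  assumes "\<xi> permutes {1..d}" "x \<in> L" "i \<in> I"
  shows "loop_at \<xi> (edge x (succ_dir (cyclic \<xi>) i)) = loop_at \<xi> (edge (x - g i) i)"
proof -
  note c = cyclic_permutes[OF assms(1)]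
  have "succ_dir (cyclic \<xi>) i \<in> I" using perm_I[OF succ_dir_permutes[OF c] assms(3)] .
  then show ?thesis
    using assms loop_at_edge(1) lattice_diff_gen offset_succ_dir[OF c assms(3)]
    by (simp add: algebra_simps)
qed

section \<open>Height functions and tilings\<close>

definition incr :: "point set set \<Rightarrow> point \<Rightarrow> nat \<Rightarrow> int" where
  "incr Y x i = (if edge x i \<in> Y then - int d else 1)"

lemma edge_in_tiling_of:
  assumes "x \<in> L" "i \<in> I"
  shows "edge x i \<in> tiling_of d h \<longleftrightarrow> h (x + g i) - h x = - int d"
proof
  assume "edge x i \<in> tiling_of d h"
  then obtain y j where "edge x i = edge y j" "j \<in> I" "h (y + g j) - h y = - int d"
    unfolding tiling_of_def edge_def by blast
  then show "h (x + g i) - h x = - int d" using edge_inject[OF assms(2)] by metis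
next
  assume "h (x + g i) - h x = - int d"
  then show "edge x i \<in> tiling_of d h"
    unfolding tiling_of_def edge_def using assms by blast
qed

lemma tiling_of_subset: "tiling_of d h \<subseteq> lattice_edges d"
  unfolding tiling_of_def lattice_edges_def by blast

lemma height_functions_step:
  assumes "h \<in> height_functions d" "x \<in> L" "i \<in> I"
  shows "h (x + g i) - h x = 1 \<or> h (x + g i) - h x = - int d"
  using assms unfolding height_functions_def by blast

lemma height_functions_incr:
  assumes "h \<in> height_functions d" "x \<in> L" "i \<in> I"
  shows "h (x + g i) = h x + incr (tiling_of d h) x i"
  using height_functions_step[OF assms] edge_in_tiling_of[OF assms(2,3), of h]
  by (auto simp: incr_def)

text \<open>Each of the d+1 steps contributes 1, lowered by d+1 on an edge of \<open>Y\<close>.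
  Hence increments close up around a loop iff \<open>Y\<close> contains exactly one of its edges,
  which links heights and tilings in both directions.\<close>

lemma sum_incr_cycle:
  assumes "x \<in> L" "\<zeta> permutes I"
  shows "(\<Sum>k\<in>I. incr Y (walk x \<zeta> (k - 1)) (\<zeta> k))
    = (int d + 1) * (1 - int (card (Y \<inter> cycle_edges x \<zeta>)))"
proof -
  define e where "e k = edge (walk x \<zeta> (k - 1)) (\<zeta> k)" for k
  have "inj_on e I"
  proof (rule inj_onI)
    fix k m assume "k \<in> I" "m \<in> I" "e k = e m"
    then have "\<zeta> k = \<zeta> m"
      unfolding e_def using edge_inject[OF perm_I[OF assms(2)] perm_I[OF assms(2)], of k m] by blast
    then show "k = m" using permutes_inj[OF assms(2)] by (auto dest: injD)
  qed
  then have card: "card (Y \<inter> cycle_edges x \<zeta>) = card {k\<in>I. e k \<in> Y}"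
  proof -
    have "Y \<inter> cycle_edges x \<zeta> = e ` {k\<in>I. e k \<in> Y}"
      unfolding cycle_edges_def e_def by blast
    moreover have "inj_on e {k\<in>I. e k \<in> Y}"
      using \<open>inj_on e I\<close> by (rule inj_on_subset) blast
    ultimately show ?thesis by (simp add: card_image)
  qed
  have "(\<Sum>k\<in>I. incr Y (walk x \<zeta> (k - 1)) (\<zeta> k))
      = (\<Sum>k\<in>I. 1 - (int d + 1) * of_bool (e k \<in> Y))"
    by (intro sum.cong refl) (simp add: incr_def e_def)
  also have "\<dots> = int (card I) - (int d + 1) * (\<Sum>k\<in>I. of_bool (e k \<in> Y))"
    by (simp only: sum_subtractf sum_distrib_left[symmetric]) simp
  also have "(\<Sum>k\<in>I. of_bool (e k \<in> Y)) = int (card {k\<in>I. e k \<in> Y})"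
    by (simp only: sum.inter_filter[symmetric] of_bool_def finite_atLeastAtMost) simp
  finally show ?thesis unfolding card by (simp add: algebra_simps)
qed

lemma tiling_of_in_tilings:
  assumes "h \<in> height_functions d"
  shows "tiling_of d h \<in> tilings d"
  unfolding tilings_iff
proof (intro conjI ballI tiling_of_subset)
  fix l assume "l \<in> loops d"
  then obtain y \<xi> where l: "l = (y, \<xi>)" "y \<in> L" "\<xi> permutes {1..d}" by (auto simp: loops_def)
  define \<zeta> where "\<zeta> = cyclic \<xi>"
  have \<zeta>: "\<zeta> permutes I" unfolding \<zeta>_def by (rule cyclic_permutes[OF l(3)])
  have "(\<Sum>k\<in>I. incr (tiling_of d h) (walk y \<zeta> (k - 1)) (\<zeta> k))
      = (\<Sum>k\<in>I. h (walk y \<zeta> k) - h (walk y \<zeta> (k - 1)))"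
  proof (rule sum.cong[OF refl])
    fix k assume k: "k \<in> I"
    then have "k - 1 \<le> d + 1" by auto
    then show "incr (tiling_of d h) (walk y \<zeta> (k - 1)) (\<zeta> k) = h (walk y \<zeta> k) - h (walk y \<zeta> (k - 1))"
      using height_functions_incr[OF assms walk_in_lattice[OF l(2) \<zeta>, of "k - 1"] perm_I[OF \<zeta> k]]
        walk_step[OF k, of y \<zeta>] by simp
  qed
  also have "\<dots> = (\<Sum>k<d+1. h (walk y \<zeta> (Suc k)) - h (walk y \<zeta> k))"
    by (rule sum.reindex_bij_witness[of _ Suc "\<lambda>k. k - 1"]) auto
  also have "\<dots> = h (walk y \<zeta> (d + 1)) - h (walk y \<zeta> 0)"
    by (rule sum_lessThan_telescope)
  also have "\<dots> = 0" unfolding walk_closed[OF \<zeta>] by simp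
  finally have "(int d + 1) * (1 - int (card (tiling_of d h \<inter> cycle_edges y \<zeta>))) = 0"
    unfolding sum_incr_cycle[OF l(2) \<zeta>] .
  then show "card (tiling_of d h \<inter> loop_edges d l) = 1"
    unfolding l(1) loop_edges_eq[OF l(3)] \<zeta>_def[symmetric] by simp
qed

text \<open>The two loops that start at \<open>x\<close> with the increments \<open>i, j\<close> and \<open>j, i\<close> and agree afterwards
  have the same total increment, namely zero.\<close>

lemma incr_square:
  assumes Y: "Y \<in> tilings d" and x: "x \<in> L" and ij: "i \<in> I" "j \<in> I"
  shows "incr Y x i + incr Y (x + g i) j = incr Y x j + incr Y (x + g j) i"
proof (cases "i = j")
  case False
  obtain \<zeta> where \<zeta>: "\<zeta> permutes I" "\<zeta> 1 = i" "\<zeta> 2 = j"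
    using ex_perm_first_two[OF ij False] .
  define \<eta> where "\<eta> = \<zeta> \<circ> transpose 1 2"
  have \<eta>: "\<eta> permutes I"
    unfolding \<eta>_def using d_ge_2 by (intro permutes_compose[OF _ \<zeta>(1)] permutes_swap_id) auto
  have \<eta>12: "\<eta> 1 = j" "\<eta> 2 = i" using \<zeta> by (simp_all add: \<eta>_def)
  have \<eta>3: "\<eta> k = \<zeta> k" if "k \<ge> 3" for k using that by (simp add: \<eta>_def transpose_def)
  have w1: "walk x \<zeta> 1 = x + g i" "walk x \<eta> 1 = x + g j"
    using walk_Suc[of x _ 0] \<zeta> \<eta>12 by simp_all
  have w2: "walk x \<eta> k = walk x \<zeta> k" if "k \<ge> 2" for k
    using that
  proof (induction k rule: dec_induct)
    case base
    show ?case using walk_Suc[of x _ 1] w1 \<zeta>(3) \<eta>12(2) by (simp add: numeral_2_eq_2 algebra_simps)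
  next
    case (step k)
    then show ?case using \<eta>3[of "Suc k"] by (simp add: walk_Suc)
  qed
  have zero: "(\<Sum>k\<in>I. incr Y (walk x \<sigma> (k - 1)) (\<sigma> k)) = 0" if "\<sigma> permutes I" for \<sigma>
    unfolding sum_incr_cycle[OF x that] tilings_cycle[OF Y x that] by simp
  have split: "(\<Sum>k\<in>I. F k) = F 1 + F 2 + (\<Sum>k\<in>{3..d+1}. F k)" for F :: "nat \<Rightarrow> int"
  proof -
    have "I = insert 1 (insert 2 {3..d+1})" using d_ge_2 by auto
    then show ?thesis by simp
  qed
  have "(\<Sum>k\<in>{3..d+1}. incr Y (walk x \<eta> (k - 1)) (\<eta> k))
      = (\<Sum>k\<in>{3..d+1}. incr Y (walk x \<zeta> (k - 1)) (\<zeta> k))"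
  proof (rule sum.cong[OF refl])
    fix k assume "k \<in> {3..d+1}"
    then have "2 \<le> k - 1" "3 \<le> k" by auto
    then show "incr Y (walk x \<eta> (k - 1)) (\<eta> k) = incr Y (walk x \<zeta> (k - 1)) (\<zeta> k)"
      by (simp only: w2 \<eta>3)
  qed
  moreover have "incr Y x i + incr Y (x + g i) j + (\<Sum>k\<in>{3..d+1}. incr Y (walk x \<zeta> (k - 1)) (\<zeta> k)) = 0"
    using zero[OF \<zeta>(1)] unfolding split \<zeta>(2,3) using w1 by simp
  moreover have "incr Y x j + incr Y (x + g j) i + (\<Sum>k\<in>{3..d+1}. incr Y (walk x \<eta> (k - 1)) (\<eta> k)) = 0"
    using zero[OF \<eta>] unfolding split \<eta>12 using w1 by simp
  ultimately show ?thesis by linarith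
qed simp

subsection \<open>Rays\<close>

definition ray :: "point \<Rightarrow> nat \<Rightarrow> point" where
  "ray x k = (\<lambda>j. x j + real k * g 1 j)"

lemma ray_0 [simp]: "ray x 0 = x"
  by (simp add: ray_def)

lemma ray_Suc: "ray x (Suc k) = ray x k + g 1"
  by (auto simp: ray_def fun_eq_iff algebra_simps)

lemma ray_add: "ray (x + y) k = ray x k + y"
  by (auto simp: ray_def fun_eq_iff)

lemma ray_ray: "ray (ray x k) m = ray x (k + m)"
  by (auto simp: ray_def fun_eq_iff algebra_simps)

lemma one_in_I: "1 \<in> I"
  by simp

lemma ray_in_lattice: "x \<in> L \<Longrightarrow> ray x k \<in> L"
proof (induction k)
  case (Suc k)
  then show ?case unfolding ray_Suc by (intro lattice_add_gen[OF _ one_in_I]) simp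
qed simp

lemma inj_ray: "inj (ray x)"
proof (rule injI)
  fix k m assume "ray x k = ray x m"
  then have "real k * g 1 1 = real m * g 1 1" by (auto simp: ray_def dest: fun_cong[of _ _ 1])
  moreover have "g 1 1 \<noteq> 0" using d_ge_2 gen_apply[OF one_in_I, of 1] by simp
  ultimately show "k = m" by simp
qed

text \<open>The ray is injective and so visits the finite set \<open>R\<close> at only finitely many
  indices.\<close>

lemma ray_leaves:
  assumes "finite R"
  obtains N where "\<And>k. N \<le> k \<Longrightarrow> ray x k \<notin> R"
proof -
  have "finite (ray x -` R)" by (rule finite_vimageI[OF assms inj_ray])
  then obtain N where "\<forall>k\<in>ray x -` R. k < N" using finite_nat_set_iff_bounded by blast
  then have "ray x k \<notin> R" if "N \<le> k" for k using that by (meson leD vimageI2)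
  then show ?thesis by (rule that)
qed

end

section \<open>Height functions and tilings with boundary conditions\<close>

locale height_region = simplicial +
  fixes R :: "point set" and f :: "point \<Rightarrow> int"
  assumes region: "region d R" and height: "f \<in> height_functions d"
begin

abbreviation "T \<equiv> tiling_of d f"
abbreviation "ER \<equiv> region_edges d R"
abbreviation "\<Omega> \<equiv> height_functions_on d R f"
abbreviation "\<Theta> \<equiv> tilings_on d R T"

lemma finite_region: "finite R"
  using region by (simp add: region_def)

lemma region_subset: "R \<subseteq> L"
  using region by (simp add: region_def)

lemma edge_in_region_edges:
  "x \<in> L \<Longrightarrow> i \<in> I \<Longrightarrow> edge x i \<in> ER \<longleftrightarrow> x \<in> R \<or> x + g i \<in> R"
  using edge_in_lattice_edges[of x i] by (auto simp: region_edges_def edge_def)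

lemma finite_region_edges: "finite ER"
proof (rule finite_subset)
  show "ER \<subseteq> (\<lambda>(x, i). edge x i) ` (R \<times> I) \<union> (\<lambda>(x, i). edge (x - g i) i) ` (R \<times> I)"
  proof
    fix e assume e: "e \<in> ER"
    then obtain x i where x: "x \<in> L" "i \<in> I" "e = edge x i"
      by (metis (no_types, lifting) lattice_edgeE mem_Collect_eq region_edges_def)
    then have "x \<in> R \<or> x + g i \<in> R" using e edge_in_region_edges by blast
    then show "e \<in> (\<lambda>(x, i). edge x i) ` (R \<times> I) \<union> (\<lambda>(x, i). edge (x - g i) i) ` (R \<times> I)"
    proof
      assume "x \<in> R"
      then show ?thesis using x by blast
    next
      assume "x + g i \<in> R"
      then have "e \<in> (\<lambda>(x, i). edge (x - g i) i) ` (R \<times> I)"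
        using x by (intro image_eqI[of _ _ "(x + g i, i)"]) auto
      then show ?thesis by blast
    qed
  qed
qed (use finite_region in auto)

lemma tiling_in_tilings: "T \<in> tilings d"
  by (rule tiling_of_in_tilings[OF height])

text \<open>Outside the finite set \<open>ER\<close> all members of \<open>\<Theta>\<close> agree
  with \<open>T\<close>, so each is determined by its intersection with \<open>ER\<close>.\<close>

lemma finite_tilings_on: "finite \<Theta>"
proof (rule finite_imageD)
  show "finite ((\<lambda>Y. Y \<inter> ER) ` \<Theta>)"
    by (rule finite_subset[of _ "Pow ER"]) (auto simp: finite_region_edges)
  show "inj_on (\<lambda>Y. Y \<inter> ER) \<Theta>"
    by (auto simp: inj_on_def tilings_on_def)
qed

lemma height_functions_onD:
  assumes "h \<in> \<Omega>"
  shows "h \<in> height_functions d" and "\<And>x. x \<in> L \<Longrightarrow> x \<notin> R \<Longrightarrow> h x = f x"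
  using assms by (auto simp: height_functions_on_def)

lemma height_functions_eqI:
  assumes "h \<in> height_functions d" "h' \<in> height_functions d" "\<And>x. x \<in> L \<Longrightarrow> h x = h' x"
  shows "h = h'"
  using assms by (intro extensionalityI[of h L h']) (auto simp: height_functions_def)

lemma tiling_of_in_tilings_on:
  assumes "h \<in> \<Omega>"
  shows "tiling_of d h \<in> \<Theta>"
proof -
  have "edge x i \<in> tiling_of d h \<longleftrightarrow> edge x i \<in> T" if "x \<in> L" "i \<in> I" "edge x i \<notin> ER" for x i
    using that edge_in_region_edges[OF that(1,2)] height_functions_onD(2)[OF assms]
      lattice_add_gen[OF that(1,2)] by (simp add: edge_in_tiling_of)
  then have "e \<in> tiling_of d h \<longleftrightarrow> e \<in> T" if "e \<in> lattice_edges d" "e \<notin> ER" for e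
    using that by (metis lattice_edgeE)
  then have "tiling_of d h - ER = T - ER" using tiling_of_subset by blast
  then show ?thesis
    using tiling_of_in_tilings[OF height_functions_onD(1)[OF assms]] by (simp add: tilings_on_def)
qed

lemma inj_on_tiling_of: "inj_on (tiling_of d) \<Omega>"
proof (rule inj_onI)
  fix h h' assume h: "h \<in> \<Omega>" "h' \<in> \<Omega>" and eq: "tiling_of d h = tiling_of d h'"
  note hf = height_functions_onD(1)[OF h(1)] height_functions_onD(1)[OF h(2)]
  show "h = h'"
  proof (rule height_functions_eqI[OF hf])
    fix x assume x: "x \<in> L"
    have "h (ray x k) - h' (ray x k) = h x - h' x" for k
    proof (induction k)
      case (Suc k)
      note hf[THEN height_functions_incr, OF ray_in_lattice[OF x, of k] one_in_I, folded ray_Suc]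
      then show ?case using Suc eq by simp
    qed simp
    moreover obtain N where "\<And>k. N \<le> k \<Longrightarrow> ray x k \<notin> R" using ray_leaves[OF finite_region] by blast
    then have "h (ray x N) = h' (ray x N)"
      using height_functions_onD(2)[OF h(1)] height_functions_onD(2)[OF h(2)]
        ray_in_lattice[OF x] by simp
    ultimately show "h x = h' x" by (metis diff_self eq_iff_diff_eq_0)
  qed
qed

text \<open>Integrating along rays that leave the region avoids the construction of a global potential.\<close>

context
  fixes Y :: "point set set"
  assumes Y: "Y \<in> \<Theta>"
begin

definition \<delta> :: "point \<Rightarrow> nat \<Rightarrow> int" where
  "\<delta> x i = incr Y x i - incr T x i"

text \<open>The candidate for \<open>h - f\<close>, normalised to vanish far out on the ray. The
  index set consists of the steps that touch \<open>R\<close>; it is finite since the ray is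
  injective.\<close>

definition shift :: "point \<Rightarrow> int" where
  "shift x = - (\<Sum>k | ray x k \<in> R \<or> ray x (Suc k) \<in> R. \<delta> (ray x k) 1)"

lemma \<delta>_eq_0:
  assumes "x \<in> L" "i \<in> I" "x \<notin> R" "x + g i \<notin> R"
  shows "\<delta> x i = 0"
proof -
  have "edge x i \<notin> ER" using assms edge_in_region_edges by blast
  then have "edge x i \<in> Y \<longleftrightarrow> edge x i \<in> T" using Y unfolding tilings_on_def by blast
  then show ?thesis by (simp add: \<delta>_def incr_def)
qed

lemma \<delta>_square:
  assumes "x \<in> L" "i \<in> I" "j \<in> I"
  shows "\<delta> x i + \<delta> (x + g i) j = \<delta> x j + \<delta> (x + g j) i"
proof -
  have "Y \<in> tilings d" using Y unfolding tilings_on_def by blast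
  from incr_square[OF this assms] incr_square[OF tiling_in_tilings assms]
  show ?thesis by (simp add: \<delta>_def)
qed

lemma shift_eq:
  assumes "x \<in> L" "\<And>k. N \<le> k \<Longrightarrow> ray x k \<notin> R"
  shows "shift x = - (\<Sum>k<N. \<delta> (ray x k) 1)"
proof -
  have "(\<Sum>k | ray x k \<in> R \<or> ray x (Suc k) \<in> R. \<delta> (ray x k) 1) = (\<Sum>k<N. \<delta> (ray x k) 1)"
  proof (rule sum.mono_neutral_left)
    show "{k. ray x k \<in> R \<or> ray x (Suc k) \<in> R} \<subseteq> {..<N}"
    proof
      fix k assume "k \<in> {k. ray x k \<in> R \<or> ray x (Suc k) \<in> R}"
      then have "\<not> N \<le> k" using assms(2)[of k] assms(2)[of "Suc k"] by auto
      then show "k \<in> {..<N}" by simp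
    qed
    show "\<forall>k\<in>{..<N} - {k. ray x k \<in> R \<or> ray x (Suc k) \<in> R}. \<delta> (ray x k) 1 = 0"
      using \<delta>_eq_0[OF ray_in_lattice[OF assms(1)] one_in_I] by (simp add: ray_Suc)
  qed simp
  then show ?thesis by (simp add: shift_def)
qed

text \<open>The rays from \<open>x\<close> and \<open>x + g i\<close> run in parallel. The square
  relation, applied to each cell of the strip between them, turns the difference of the two sums
  into a telescoping sum whose far end lies outside \<open>R\<close> and vanishes.\<close>

lemma shift_add_gen:
  assumes x: "x \<in> L" and i: "i \<in> I"
  shows "shift (x + g i) = shift x + \<delta> x i"
proof -
  obtain N1 where N1: "\<And>k. N1 \<le> k \<Longrightarrow> ray x k \<notin> R" using ray_leaves[OF finite_region] by blast
  obtain N2 where N2: "\<And>k. N2 \<le> k \<Longrightarrow> ray (x + g i) k \<notin> R" using ray_leaves[OF finite_region] by blast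
  define N where "N = max N1 N2"
  have N: "ray x k \<notin> R" "ray (x + g i) k \<notin> R" if "N \<le> k" for k
    using that N1[of k] N2[of k] by (auto simp: N_def)
  have "shift (x + g i) - shift x = (\<Sum>k<N. \<delta> (ray x k) 1 - \<delta> (ray (x + g i) k) 1)"
    using shift_eq[OF x, of N] shift_eq[OF lattice_add_gen[OF x i], of N] N
    by (simp add: sum_subtractf)
  also have "\<dots> = (\<Sum>k<N. \<delta> (ray x k) i - \<delta> (ray x (Suc k)) i)"
  proof (rule sum.cong[OF refl])
    fix k
    show "\<delta> (ray x k) 1 - \<delta> (ray (x + g i) k) 1 = \<delta> (ray x k) i - \<delta> (ray x (Suc k)) i"
      using \<delta>_square[OF ray_in_lattice[OF x, of k] one_in_I i] by (simp add: ray_Suc ray_add)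
  qed
  also have "\<dots> = \<delta> x i - \<delta> (ray x N) i"
    using sum_lessThan_telescope'[of "\<lambda>k. \<delta> (ray x k) i" N] by simp
  also have "\<delta> (ray x N) i = 0"
    using N[of N] by (intro \<delta>_eq_0 ray_in_lattice x i) (simp_all add: ray_add)
  finally show ?thesis by linarith
qed

text \<open>The ray from \<open>y\<close> may pass through \<open>R\<close>, so the sum need not
  vanish term by term. It is zero at a far point of the ray, and by \<open>shift_add_gen\<close> it
  does not change along a path in the complement; connectedness of the complement joins the far
  point to \<open>y\<close>.\<close>

lemma shift_eq_0:
  assumes "y \<in> L" "y \<notin> R"
  shows "shift y = 0"
proof -
  obtain N where N: "\<And>k. N \<le> k \<Longrightarrow> ray y k \<notin> R" using ray_leaves[OF finite_region] by blast
  define z where "z = ray y N"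
  have z: "shift z = 0"
    unfolding z_def using shift_eq[OF ray_in_lattice[OF assms(1), of N], of 0] N by (simp add: ray_ray)
  define A where "A = {(u, v). u \<in> L - R \<and> v \<in> L - R \<and> {u, v} \<in> lattice_edges d}"
  have "(z, y) \<in> A\<^sup>*"
    using region N[of N] assms ray_in_lattice[OF assms(1), of N] unfolding region_def A_def z_def by blast
  then have "shift y = shift z"
  proof (induction rule: rtrancl_induct)
    case (step u v)
    then have uv: "u \<in> L - R" "v \<in> L - R" "{u, v} \<in> lattice_edges d" by (auto simp: A_def)
    then obtain x i where x: "x \<in> L" "i \<in> I" "{u, v} = {x, x + g i}"
      unfolding lattice_edges_def by blast
    then have "shift (x + g i) = shift x"
      using uv shift_add_gen[OF x(1,2)] \<delta>_eq_0[OF x(1,2)] by (auto simp: doubleton_eq_iff)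
    then have "shift v = shift u" using x(3) by (auto simp: doubleton_eq_iff)
    then show ?case using step by simp
  qed simp
  then show ?thesis using z by simp
qed

text \<open>\<open>\<delta>\<close> only takes the values 0, d+1 and -(d+1). This keeps the
  corrected height at the origin a multiple of d+1.\<close>

lemma shift_dvd: "(int d + 1) dvd shift x"
proof -
  have "(int d + 1) dvd \<delta> y i" for y i
    by (auto simp: \<delta>_def incr_def dvd_def intro: exI[of _ 1] exI[of _ "-1"])
  then show ?thesis unfolding shift_def by (simp add: dvd_sum)
qed

lemma tiling_of_surj: "\<exists>h\<in>\<Omega>. tiling_of d h = Y"
proof
  define h where "h = restrict (\<lambda>x. f x + shift x) L"
  have step: "h (x + g i) - h x = incr Y x i" if "x \<in> L" "i \<in> I" for x i
    using that lattice_add_gen[OF that] shift_add_gen[OF that] height_functions_incr[OF height that]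
    by (simp add: h_def \<delta>_def)
  have "(int d + 1) dvd f 0" using height by (simp add: height_functions_def)
  then have "h \<in> height_functions d"
    unfolding height_functions_def using step shift_dvd[of 0] zero_in_lattice
    by (auto simp: incr_def) (auto simp: h_def)
  moreover have "h x = f x" if "x \<in> L" "x \<notin> R" for x
    using that shift_eq_0 by (simp add: h_def)
  ultimately show "h \<in> \<Omega>" by (simp add: height_functions_on_def)
  have "edge x i \<in> tiling_of d h \<longleftrightarrow> edge x i \<in> Y" if "x \<in> L" "i \<in> I" for x i
    using edge_in_tiling_of[OF that] step[OF that] by (auto simp: incr_def)
  then have "e \<in> tiling_of d h \<longleftrightarrow> e \<in> Y" if "e \<in> lattice_edges d" for e
    using that by (metis lattice_edgeE)
  moreover have "Y \<subseteq> lattice_edges d" using Y by (simp add: tilings_on_def tilings_def)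
  ultimately show "tiling_of d h = Y" using tiling_of_subset by blast
qed

end

lemma bij_betw_tiling_of: "bij_betw (tiling_of d) \<Omega> \<Theta>"
  unfolding bij_betw_def using inj_on_tiling_of tiling_of_in_tilings_on tiling_of_surj by blast

subsection \<open>Flips\<close>

text \<open>Both possible increments are 1 modulo d+1, so the difference keeps its residue along the
  ray from \<open>x\<close>. The induction runs backwards from a point of the ray outside
  \<open>R\<close>, where the two functions agree.\<close>

lemma height_functions_on_cong:
  assumes h: "h \<in> \<Omega>" "h' \<in> \<Omega>" and x: "x \<in> L"
  shows "(int d + 1) dvd h x - h' x"
proof -
  note hf = height_functions_onD(1)[OF h(1)] height_functions_onD(1)[OF h(2)]
  obtain N where N: "\<And>k. N \<le> k \<Longrightarrow> ray x k \<notin> R" using ray_leaves[OF finite_region] by blast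
  have "(int d + 1) dvd h (ray x k) - h' (ray x k)" if "k \<le> N" for k
    using that
  proof (induction rule: inc_induct)
    case base
    then show ?case
      using height_functions_onD(2)[OF h(1)] height_functions_onD(2)[OF h(2)]
        ray_in_lattice[OF x] N[of N] by simp
  next
    case (step k)
    have "h (ray x k) - h' (ray x k) = (h (ray x (Suc k)) - h' (ray x (Suc k)))
        - (incr (tiling_of d h) (ray x k) 1 - incr (tiling_of d h') (ray x k) 1)"
      using hf[THEN height_functions_incr, OF ray_in_lattice[OF x, of k] one_in_I]
      by (simp add: ray_Suc)
    moreover have "(int d + 1) dvd incr (tiling_of d h) y 1 - incr (tiling_of d h') y 1" for y
      by (auto simp: incr_def dvd_def intro: exI[of _ 1] exI[of _ "-1"])
    ultimately show ?case using step.IH by (metis dvd_diff)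
  qed
  from this[of 0] show ?thesis by simp
qed

text \<open>Raising \<open>h x\<close> by d+1 turns every step into \<open>x\<close> from -d to 1
  and every step out of \<open>x\<close> from 1 to -d; no other step sees the change.\<close>

lemma flip_in_height_functions_on:
  assumes h: "h \<in> \<Omega>" and x: "x \<in> R"
    and lo: "\<And>i. i \<in> I \<Longrightarrow> h (x - g i) = h x + int d" and hi: "\<And>i. i \<in> I \<Longrightarrow> h (x + g i) = h x + 1"
  shows "h(x := h x + int d + 1) \<in> \<Omega>"
proof -
  define h' where "h' = h(x := h x + int d + 1)"
  note hf = height_functions_onD(1)[OF h]
  have xL: "x \<in> L" using x region_subset by blast
  have step: "h' (y + g i) - h' y \<in> {1, - int d}" if "y \<in> L" "i \<in> I" for y i
  proof -
    consider "y = x" | "y + g i = x" | "y \<noteq> x" "y + g i \<noteq> x" by blast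
    then show ?thesis
    proof cases
      case 1
      then have "y + g i \<noteq> x" using gen_neq_0[OF that(2)] by simp
      then show ?thesis using 1 hi[OF that(2)] by (simp add: h'_def)
    next
      case 2
      then have y: "y = x - g i" by (simp add: algebra_simps)
      then have "y \<noteq> x" using gen_neq_0[OF that(2)] by simp
      then show ?thesis using 2 lo[OF that(2)] y by (simp add: h'_def)
    next
      case 3
      then show ?thesis using height_functions_step[OF hf that] by (simp add: h'_def)
    qed
  qed
  have "(int d + 1) dvd h 0" using hf by (simp add: height_functions_def)
  then have "(int d + 1) dvd h' 0" by (auto simp: h'_def add.assoc)
  moreover have "h' \<in> extensional L"
    using hf xL by (auto simp: height_functions_def h'_def extensional_def)
  ultimately have "h' \<in> height_functions d" using step by (simp add: height_functions_def)
  then show ?thesis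
    using height_functions_onD(2)[OF h] x by (auto simp: height_functions_on_def h'_def)
qed

text \<open>Take \<open>x\<close> with least \<open>h\<close> among the vertices where
  \<open>h\<close> lies below \<open>h'\<close>. If \<open>h\<close> descended along an edge from
  \<open>x\<close>, then \<open>h'\<close> could not descend by more, so the neighbour would again
  belong to this set and have smaller \<open>h\<close>. Hence \<open>x\<close> is a local minimum,
  and the congruence modulo d+1 leaves room for a whole flip.\<close>

lemma ex_flip_towards:
  assumes h: "h \<in> \<Omega>" "h' \<in> \<Omega>" and lt: "x0 \<in> R" "h x0 < h' x0"
  obtains x where "x \<in> R" "h x + int d + 1 \<le> h' x"
    "\<And>i. i \<in> I \<Longrightarrow> h (x - g i) = h x + int d" "\<And>i. i \<in> I \<Longrightarrow> h (x + g i) = h x + 1"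
proof -
  note hf = height_functions_onD(1)[OF h(1)] height_functions_onD(1)[OF h(2)]
  define A where "A = {x \<in> R. h x < h' x}"
  have A: "finite A" "x0 \<in> A" using finite_region lt by (auto simp: A_def)
  define x where "x = arg_min_on h A"
  have xA: "x \<in> A" unfolding x_def by (rule arg_min_if_finite(1)) (use A in auto)
  have least: "h x \<le> h y" if "y \<in> A" for y
    unfolding x_def using arg_min_least[OF A(1) _ that, of h] A by blast
  have x: "x \<in> R" "x \<in> L" "h x < h' x" using xA region_subset by (auto simp: A_def)
  have inA: "y \<in> A" if "y \<in> L" "h y < h' y" for y
    using that(2) height_functions_onD(2)[OF h(1) that(1)] height_functions_onD(2)[OF h(2) that(1)]
    unfolding A_def by (cases "y \<in> R") simp_all
  have "h x + int d + 1 \<le> h' x"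
  proof -
    have "(int d + 1) dvd h' x - h x" by (rule height_functions_on_cong[OF h(2,1) x(2)])
    then have "int d + 1 \<le> h' x - h x" using x(3) by (intro zdvd_imp_le) auto
    then show ?thesis by simp
  qed
  moreover have "h (x - g i) = h x + int d" if i: "i \<in> I" for i
  proof -
    note y = lattice_diff_gen[OF x(2) i]
    have *: "h x - h (x - g i) = 1 \<or> h x - h (x - g i) = - int d"
      using height_functions_step[OF hf(1) y i] by simp
    moreover have "h x - h (x - g i) \<noteq> 1"
    proof
      assume eq: "h x - h (x - g i) = 1"
      have "h' x - h' (x - g i) \<le> 1"
        using height_functions_step[OF hf(2) y i] by auto
      then have "x - g i \<in> A" using eq x(3) by (intro inA[OF y]) linarith
      then show False using least eq by fastforce
    qed
    ultimately show ?thesis by simp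
  qed
  moreover have "h (x + g i) = h x + 1" if i: "i \<in> I" for i
  proof -
    note y = lattice_add_gen[OF x(2) i]
    have *: "h (x + g i) - h x = 1 \<or> h (x + g i) - h x = - int d"
      by (rule height_functions_step[OF hf(1) x(2) i])
    moreover have "h (x + g i) - h x \<noteq> - int d"
    proof
      assume eq: "h (x + g i) - h x = - int d"
      have "h' (x + g i) - h' x \<ge> - int d"
        using height_functions_step[OF hf(2) x(2) i] by auto
      then have "x + g i \<in> A" using eq x(3) by (intro inA[OF y]) linarith
      then show False using least eq d_ge_2 by fastforce
    qed
    ultimately show ?thesis by simp
  qed
  ultimately show ?thesis using that x(1) by blast
qed

text \<open>Induction on the sum of the distances over \<open>R\<close>. Upward flips suffice: at a
  vertex where the functions differ, the lower of the two is raised, whichever it is.\<close>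

lemma flip_invariant:
  fixes s :: "(point \<Rightarrow> int) \<Rightarrow> 'a"
  assumes flip: "\<And>h x. h \<in> \<Omega> \<Longrightarrow> x \<in> R \<Longrightarrow> (\<And>i. i \<in> I \<Longrightarrow> h (x - g i) = h x + int d) \<Longrightarrow>
      (\<And>i. i \<in> I \<Longrightarrow> h (x + g i) = h x + 1) \<Longrightarrow> s (h(x := h x + int d + 1)) = s h"
    and h: "h \<in> \<Omega>" "h' \<in> \<Omega>"
  shows "s h = s h'"
  using h
proof (induction "nat (\<Sum>x\<in>R. \<bar>h x - h' x\<bar>)" arbitrary: h h' rule: less_induct)
  case less
  have closer: "\<exists>h1\<in>\<Omega>. s h1 = s h \<and> nat (\<Sum>x\<in>R. \<bar>h1 x - h' x\<bar>) < nat (\<Sum>x\<in>R. \<bar>h x - h' x\<bar>)"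
    if h: "h \<in> \<Omega>" "h' \<in> \<Omega>" and ex: "x0 \<in> R" "h x0 < h' x0" for h h' x0
  proof -
    obtain x where x: "x \<in> R" "h x + int d + 1 \<le> h' x"
      and lo: "\<And>i. i \<in> I \<Longrightarrow> h (x - g i) = h x + int d" and hi: "\<And>i. i \<in> I \<Longrightarrow> h (x + g i) = h x + 1"
      using ex_flip_towards[OF h ex] by blast
    define h1 where "h1 = h(x := h x + int d + 1)"
    \<comment> \<open>The flipped value does not exceed \<open>h' x\<close>, so the distance drops
      by d+1 at \<open>x\<close> and stays the same elsewhere.\<close>
    have "(\<Sum>x\<in>R. \<bar>h1 x - h' x\<bar>) < (\<Sum>x\<in>R. \<bar>h x - h' x\<bar>)"
      using x by (intro sum_strict_mono_ex1[OF finite_region]) (auto simp: h1_def)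
    then have "nat (\<Sum>x\<in>R. \<bar>h1 x - h' x\<bar>) < nat (\<Sum>x\<in>R. \<bar>h x - h' x\<bar>)"
      using sum_nonneg[of R "\<lambda>x. \<bar>h1 x - h' x\<bar>", OF abs_ge_zero] by linarith
    moreover have "h1 \<in> \<Omega>" unfolding h1_def by (rule flip_in_height_functions_on[OF h(1) x(1) lo hi])
    moreover have "s h1 = s h" unfolding h1_def by (rule flip[OF h(1) x(1) lo hi])
    ultimately show ?thesis by blast
  qed
  show ?case
  proof (cases "\<exists>x\<in>R. h x \<noteq> h' x")
    case False
    have "h x = h' x" if "x \<in> L" for x
      using False less.prems[THEN height_functions_onD(2), OF that] by (cases "x \<in> R") auto
    then have "h = h'"
      by (rule height_functions_eqI[OF less.prems[THEN height_functions_onD(1)]])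
    then show ?thesis by simp
  next
    case True
    then obtain x where x: "x \<in> R" "h x < h' x \<or> h' x < h x" by fastforce
    from x(2) show ?thesis
    proof
      assume "h x < h' x"
      then obtain h1 where "h1 \<in> \<Omega>" "s h1 = s h"
        "nat (\<Sum>x\<in>R. \<bar>h1 x - h' x\<bar>) < nat (\<Sum>x\<in>R. \<bar>h x - h' x\<bar>)"
        using closer[OF less.prems x(1)] by blast
      then show ?thesis using less.hyps[of h1 h'] less.prems by simp
    next
      assume "h' x < h x"
      then obtain h1 where "h1 \<in> \<Omega>" "s h1 = s h'"
        "nat (\<Sum>x\<in>R. \<bar>h1 x - h x\<bar>) < nat (\<Sum>x\<in>R. \<bar>h' x - h x\<bar>)"
        using closer[OF less.prems(2,1) x(1)] by blast
      then show ?thesis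
        using less.hyps[of h h1] less.prems by (simp add: abs_minus_commute)
    qed
  qed
qed

lemma tiling_of_flip:
  assumes h: "h \<in> \<Omega>" and x: "x \<in> R"
    and lo: "\<And>i. i \<in> I \<Longrightarrow> h (x - g i) = h x + int d" and hi: "\<And>i. i \<in> I \<Longrightarrow> h (x + g i) = h x + 1"
  shows "\<And>i. i \<in> I \<Longrightarrow> edge (x - g i) i \<in> tiling_of d h"
    and "\<And>i. i \<in> I \<Longrightarrow> edge x i \<in> tiling_of d (h(x := h x + int d + 1))"
    and "\<And>e. e \<in> tiling_of d h \<Longrightarrow> (\<And>i. i \<in> I \<Longrightarrow> e \<noteq> edge (x - g i) i) \<Longrightarrow>
      e \<in> tiling_of d (h(x := h x + int d + 1))"
proof -
  have xL: "x \<in> L" using x region_subset by blast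
  show "edge (x - g i) i \<in> tiling_of d h" if "i \<in> I" for i
    using edge_in_tiling_of[OF lattice_diff_gen[OF xL that] that] lo[OF that] by simp
  show "edge x i \<in> tiling_of d (h(x := h x + int d + 1))" if "i \<in> I" for i
    using edge_in_tiling_of[OF xL that] hi[OF that] gen_neq_0[OF that] by simp
  show "e \<in> tiling_of d (h(x := h x + int d + 1))"
    if e: "e \<in> tiling_of d h" and ne: "\<And>i. i \<in> I \<Longrightarrow> e \<noteq> edge (x - g i) i" for e
  proof -
    obtain y i where y: "y \<in> L" "i \<in> I" "e = edge y i"
      using e tiling_of_subset lattice_edgeE by (metis subsetD)
    have "h (y + g i) - h y = - int d" using e edge_in_tiling_of[OF y(1,2)] y(3) by simp
    moreover have "y \<noteq> x" using calculation hi[OF y(2)] by auto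
    moreover have "y + g i \<noteq> x"
    proof
      assume "y + g i = x"
      then have "y = x - g i" by (simp add: algebra_simps)
      then show False using ne[OF y(2)] y(3) by simp
    qed
    ultimately show ?thesis using edge_in_tiling_of[OF y(1,2)] y(3) by simp
  qed
qed

end

section \<open>The hyperdeterminant\<close>

locale kasteleyn_region = height_region +
  fixes n :: nat and \<Xi> :: "nat \<Rightarrow> nat \<Rightarrow> nat" and \<nu> :: "nat \<Rightarrow> nat \<Rightarrow> simplicial_loop"
  assumes \<Xi>: "bij_betw \<Xi> {1..fact d} {\<xi>. \<xi> permutes {1..d}}"
    and \<nu>: "\<And>i. i \<in> {1..fact d} \<Longrightarrow> bij_betw (\<nu> i) {1..n} (loop_class d R (tiling_of d f) (\<Xi> i))"
begin

abbreviation "J \<equiv> {1..fact d :: nat}"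
abbreviation "N \<equiv> {1..n}"
abbreviation "cls i \<equiv> loop_class d R T (\<Xi> i)"

lemma one_in_J: "1 \<in> J"
  by simp

lemma \<Xi>_permutes: "i \<in> J \<Longrightarrow> \<Xi> i permutes {1..d}"
  using bij_betwE[OF \<Xi>] by blast

lemma \<nu>_in_cls: "i \<in> J \<Longrightarrow> k \<in> N \<Longrightarrow> \<nu> i k \<in> cls i"
  using bij_betwE[OF \<nu>] by blast

lemma \<nu>_inject: "i \<in> J \<Longrightarrow> k \<in> N \<Longrightarrow> k' \<in> N \<Longrightarrow> \<nu> i k = \<nu> i k' \<Longrightarrow> k = k'"
  using bij_betw_imp_inj_on[OF \<nu>] by (blast dest: inj_onD)

lemma in_cls_iff:
  "i \<in> J \<Longrightarrow> l \<in> cls i \<longleftrightarrow> l \<in> loops d \<and> snd l = \<Xi> i \<and> (\<exists>e\<in>T \<inter> ER. e \<in> loop_edges d l)"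
  using \<Xi>_permutes[of i] by (cases l) (auto simp: loop_class_def loops_def)

lemma cls_in_loops: "i \<in> J \<Longrightarrow> l \<in> cls i \<Longrightarrow> l \<in> loops d"
  using in_cls_iff by blast

lemma region_edges_subset: "ER \<subseteq> lattice_edges d"
  unfolding region_edges_def by blast

lemma hyperedge_eq:
  assumes "e \<in> lattice_edges d"
  shows "hyperedge d e = (\<lambda>i. loop_at (\<Xi> i) e) ` J"
proof (intro equalityI subsetI)
  fix l assume "l \<in> hyperedge d e"
  then have l: "l \<in> loops d" "e \<in> loop_edges d l" by (auto simp: hyperedge_def)
  then have "snd l permutes {1..d}" by (auto simp: loops_def)
  then have "snd l \<in> \<Xi> ` J" using bij_betw_imp_surj_on[OF \<Xi>] by blast
  then obtain i where i: "i \<in> J" "snd l = \<Xi> i" by blast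
  then have "l = loop_at (\<Xi> i) e"
    using in_loop_edges_iff[OF \<Xi>_permutes[OF i(1)] assms l(1)] l(2) by blast
  then show "l \<in> (\<lambda>i. loop_at (\<Xi> i) e) ` J" using i(1) by blast
next
  fix l assume "l \<in> (\<lambda>i. loop_at (\<Xi> i) e) ` J"
  then obtain i where i: "i \<in> J" "l = loop_at (\<Xi> i) e" by blast
  then show "l \<in> hyperedge d e"
    using loop_at_in_loops[OF \<Xi>_permutes[OF i(1)] assms] in_loop_edges_loop_at[OF \<Xi>_permutes[OF i(1)] assms]
    by (simp add: hyperedge_def)
qed

section \<open>Tiling edges and the loops of one class\<close>

definition edge_of :: "point set set \<Rightarrow> simplicial_loop \<Rightarrow> point set" where
  "edge_of Y l = (THE e. e \<in> Y \<and> e \<in> loop_edges d l)"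

lemma
  assumes "Y \<in> tilings d" "l \<in> loops d"
  shows edge_of_in: "edge_of Y l \<in> Y" "edge_of Y l \<in> loop_edges d l"
    and edge_of_eqI: "\<And>e. e \<in> Y \<Longrightarrow> e \<in> loop_edges d l \<Longrightarrow> edge_of Y l = e"
proof -
  obtain e where e: "Y \<inter> loop_edges d l = {e}"
    using assms unfolding tilings_iff by (meson card_1_singletonE)
  have "edge_of Y l = e" unfolding edge_of_def by (rule the_equality) (use e in blast)+
  then show "edge_of Y l \<in> Y" "edge_of Y l \<in> loop_edges d l"
    "\<And>e. e \<in> Y \<Longrightarrow> e \<in> loop_edges d l \<Longrightarrow> edge_of Y l = e" using e by blast+
qed

lemma tilings_onD:
  assumes "Y \<in> \<Theta>"
  shows "Y \<in> tilings d" "Y - ER = T - ER" "Y \<subseteq> lattice_edges d"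
  using assms by (auto simp: tilings_on_def tilings_def)

text \<open>The classes are defined through \<open>T\<close> but serve every tiling in
  \<open>\<Theta>\<close>. An edge of \<open>Y\<close> outside \<open>ER\<close> is an edge of
  \<open>T\<close>, and the loop would then carry two edges of \<open>T\<close>, one inside
  \<open>ER\<close> and one outside.\<close>

lemma edge_of_in_region:
  assumes Y: "Y \<in> \<Theta>" and i: "i \<in> J" and l: "l \<in> cls i"
  shows "edge_of Y l \<in> ER"
proof (rule ccontr)
  note lL = cls_in_loops[OF i l]
  assume "edge_of Y l \<notin> ER"
  then have "edge_of Y l \<in> T" using edge_of_in(1)[OF tilings_onD(1)[OF Y] lL] tilings_onD(2)[OF Y] by blast
  moreover obtain e where e: "e \<in> T \<inter> ER" "e \<in> loop_edges d l" using l in_cls_iff[OF i] by blast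
  ultimately have "edge_of Y l = e"
    using edge_of_eqI[OF tiling_in_tilings lL, of "edge_of Y l"] edge_of_eqI[OF tiling_in_tilings lL, of e]
      edge_of_in(2)[OF tilings_onD(1)[OF Y] lL] by simp
  then show False using e \<open>edge_of Y l \<notin> ER\<close> by blast
qed

text \<open>The same argument with \<open>Y\<close> and \<open>T\<close> exchanged.\<close>

lemma loop_at_in_cls:
  assumes Y: "Y \<in> \<Theta>" and i: "i \<in> J" and e: "e \<in> Y" "e \<in> ER"
  shows "loop_at (\<Xi> i) e \<in> cls i"
proof -
  define l where "l = loop_at (\<Xi> i) e"
  note eL = subsetD[OF tilings_onD(3)[OF Y] e(1)]
  have l: "l \<in> loops d" "snd l = \<Xi> i" "e \<in> loop_edges d l"
    unfolding l_def by (rule loop_at_in_loops snd_loop_at in_loop_edges_loop_at, rule \<Xi>_permutes[OF i], rule eL)+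
  define e' where "e' = edge_of T l"
  have e': "e' \<in> T" "e' \<in> loop_edges d l"
    unfolding e'_def using edge_of_in[OF tiling_in_tilings l(1)] by blast+
  have "e' \<in> ER"
  proof (rule ccontr)
    assume "e' \<notin> ER"
    then have "e' \<in> Y" using e'(1) tilings_onD(2)[OF Y] by blast
    then have "e' = e"
      using edge_of_eqI[OF tilings_onD(1)[OF Y] l(1), of e'] edge_of_eqI[OF tilings_onD(1)[OF Y] l(1), of e]
        e'(2) e(1) l(3) by simp
    then show False using \<open>e' \<notin> ER\<close> e(2) by simp
  qed
  then show ?thesis using e' l in_cls_iff[OF i] unfolding l_def by blast
qed

lemma edge_of_loop_at:
  assumes "Y \<in> tilings d" "\<xi> permutes {1..d}" "e \<in> Y"
  shows "edge_of Y (loop_at \<xi> e) = e"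
proof -
  have "e \<in> lattice_edges d" using assms(1,3) unfolding tilings_def by blast
  from edge_of_eqI[OF assms(1) loop_at_in_loops[OF assms(2) this] assms(3)
      in_loop_edges_loop_at[OF assms(2) this]]
  show ?thesis .
qed

lemma loop_at_edge_of:
  assumes "Y \<in> tilings d" "i \<in> J" "l \<in> cls i"
  shows "loop_at (\<Xi> i) (edge_of Y l) = l"
proof -
  have l: "l \<in> loops d" "snd l = \<Xi> i" using assms(3) in_cls_iff[OF assms(2)] by simp_all
  have "edge_of Y l \<in> lattice_edges d"
    using edge_of_in(1)[OF assms(1) l(1)] assms(1) unfolding tilings_def by blast
  from in_loop_edges_iff[OF \<Xi>_permutes[OF assms(2)] this l] edge_of_in(2)[OF assms(1) l(1)]
  show ?thesis by simp
qed

text \<open>The \<open>k\<close>-th loop of class 1 has one edge in \<open>Y\<close>, and this edge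
  lies on one loop of class \<open>i\<close>, whose index is taken. Class 1 is the reference because
  the hyperdeterminant leaves its first index unpermuted; the identity outside \<open>N\<close> is
  what \<open>permutes\<close> demands.\<close>

definition perm :: "point set set \<Rightarrow> nat \<Rightarrow> nat \<Rightarrow> nat" where
  "perm Y i k = (if k \<in> N then inv_into N (\<nu> i) (loop_at (\<Xi> i) (edge_of Y (\<nu> 1 k))) else k)"

lemma
  assumes "i \<in> J" "l \<in> cls i"
  shows index_in: "inv_into N (\<nu> i) l \<in> N" and \<nu>_index: "\<nu> i (inv_into N (\<nu> i) l) = l"
proof -
  have "l \<in> \<nu> i ` N" using bij_betw_imp_surj_on[OF \<nu>[OF assms(1)]] assms(2) by blast
  then show "inv_into N (\<nu> i) l \<in> N" "\<nu> i (inv_into N (\<nu> i) l) = l"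
    by (rule inv_into_into, rule f_inv_into_f)
qed

lemma
  assumes Y: "Y \<in> \<Theta>" and i: "i \<in> J" and k: "k \<in> N"
  shows perm_in: "perm Y i k \<in> N"
    and \<nu>_perm: "\<nu> i (perm Y i k) = loop_at (\<Xi> i) (edge_of Y (\<nu> 1 k))"
proof -
  note l = \<nu>_in_cls[OF one_in_J k]
  have *: "loop_at (\<Xi> i) (edge_of Y (\<nu> 1 k)) \<in> cls i"
    using edge_of_in(1)[OF tilings_onD(1)[OF Y] cls_in_loops[OF one_in_J l]]
      edge_of_in_region[OF Y one_in_J l] by (rule loop_at_in_cls[OF Y i])
  have "perm Y i k = inv_into N (\<nu> i) (loop_at (\<Xi> i) (edge_of Y (\<nu> 1 k)))"
    unfolding perm_def using k by (rule if_P)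
  then show "perm Y i k \<in> N" "\<nu> i (perm Y i k) = loop_at (\<Xi> i) (edge_of Y (\<nu> 1 k))"
    using index_in[OF i *] \<nu>_index[OF i *] by (simp_all only:)
qed

lemma edge_of_\<nu>_inject:
  assumes "Y \<in> tilings d" "k \<in> N" "k' \<in> N" "edge_of Y (\<nu> 1 k) = edge_of Y (\<nu> 1 k')"
  shows "k = k'"
  using loop_at_edge_of[OF assms(1) one_in_J \<nu>_in_cls[OF one_in_J assms(2)]]
    loop_at_edge_of[OF assms(1) one_in_J \<nu>_in_cls[OF one_in_J assms(3)]]
  unfolding assms(4) by (intro \<nu>_inject[OF one_in_J assms(2,3)]) (rule trans[OF sym])

lemma edge_of_\<nu>_in:
  assumes "Y \<in> \<Theta>" "k \<in> N"
  shows "edge_of Y (\<nu> 1 k) \<in> Y" "edge_of Y (\<nu> 1 k) \<in> ER"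
  by (rule edge_of_in(1)[OF tilings_onD(1)[OF assms(1)] cls_in_loops[OF one_in_J \<nu>_in_cls[OF one_in_J assms(2)]]])
    (rule edge_of_in_region[OF assms(1) one_in_J \<nu>_in_cls[OF one_in_J assms(2)]])

lemma perm_permutes:
  assumes Y: "Y \<in> \<Theta>" and i: "i \<in> J"
  shows "perm Y i permutes N"
proof (rule bij_imp_permutes)
  have "inj_on (perm Y i) N"
  proof (rule inj_onI)
    fix k k' assume k: "k \<in> N" "k' \<in> N" "perm Y i k = perm Y i k'"
    then have "loop_at (\<Xi> i) (edge_of Y (\<nu> 1 k)) = loop_at (\<Xi> i) (edge_of Y (\<nu> 1 k'))"
      using \<nu>_perm[OF Y i k(1)] \<nu>_perm[OF Y i k(2)] by simp
    then have "edge_of Y (\<nu> 1 k) = edge_of Y (\<nu> 1 k')"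
      using edge_of_loop_at[OF tilings_onD(1)[OF Y] \<Xi>_permutes[OF i] edge_of_\<nu>_in(1)[OF Y k(1)]]
        edge_of_loop_at[OF tilings_onD(1)[OF Y] \<Xi>_permutes[OF i] edge_of_\<nu>_in(1)[OF Y k(2)]] by simp
    then show "k = k'" using edge_of_\<nu>_inject[OF tilings_onD(1)[OF Y] k(1,2)] by blast
  qed
  moreover have "perm Y i ` N \<subseteq> N" using perm_in[OF Y i] by blast
  ultimately show "bij_betw (perm Y i) N N"
    unfolding bij_betw_def by (metis endo_inj_surj finite_atLeastAtMost)
qed (auto simp: perm_def)

lemma perm_1:
  assumes Y: "Y \<in> \<Theta>" and k: "k \<in> N"
  shows "perm Y 1 k = k"
  using loop_at_edge_of[OF tilings_onD(1)[OF Y] one_in_J \<nu>_in_cls[OF one_in_J k]]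
    \<nu>_perm[OF Y one_in_J k] \<nu>_inject[OF one_in_J perm_in[OF Y one_in_J k] k] by simp

lemma region_part_eq:
  assumes "Y \<in> \<Theta>"
  shows "Y \<inter> ER = (\<lambda>k. edge_of Y (\<nu> 1 k)) ` N"
proof (intro equalityI subsetI)
  fix e assume e: "e \<in> Y \<inter> ER"
  then have "loop_at (\<Xi> 1) e \<in> \<nu> 1 ` N"
    using loop_at_in_cls[OF assms one_in_J] bij_betw_imp_surj_on[OF \<nu>[OF one_in_J]] by blast
  then obtain k where "k \<in> N" "\<nu> 1 k = loop_at (\<Xi> 1) e" by auto
  moreover have "edge_of Y (loop_at (\<Xi> 1) e) = e"
    using edge_of_loop_at[OF tilings_onD(1)[OF assms] \<Xi>_permutes[OF one_in_J]] e by blast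
  ultimately show "e \<in> (\<lambda>k. edge_of Y (\<nu> 1 k)) ` N" by (metis image_eqI)
next
  fix e assume "e \<in> (\<lambda>k. edge_of Y (\<nu> 1 k)) ` N"
  then show "e \<in> Y \<inter> ER" using edge_of_\<nu>_in[OF assms] by blast
qed

subsection \<open>The sign does not change under flips\<close>

text \<open>Loops whose tiling edge does not enter \<open>x\<close> keep that edge and hence their
  indices. The remaining d+1 indices of class \<open>i\<close> are labelled by the entering
  directions, and on these labels the flip acts as \<open>\<theta>\<close>.\<close>

lemma sign_perm_flip:
  assumes h: "h \<in> \<Omega>" and x: "x \<in> R"
    and lo: "\<And>i. i \<in> I \<Longrightarrow> h (x - g i) = h x + int d" and hi: "\<And>i. i \<in> I \<Longrightarrow> h (x + g i) = h x + 1"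
    and i: "i \<in> J"
  shows "sign (perm (tiling_of d (h(x := h x + int d + 1))) i) = sign (perm (tiling_of d h) i)"
proof -
  define Y where "Y = tiling_of d h"
  define Y' where "Y' = tiling_of d (h(x := h x + int d + 1))"
  have Y: "Y \<in> \<Theta>" unfolding Y_def by (rule tiling_of_in_tilings_on[OF h])
  have Y': "Y' \<in> \<Theta>"
    unfolding Y'_def by (rule tiling_of_in_tilings_on[OF flip_in_height_functions_on[OF h x lo hi]])
  note t = tilings_onD(1)[OF Y] and t' = tilings_onD(1)[OF Y']
  have flip: "edge (x - g j) j \<in> Y" "edge x j \<in> Y'" if "j \<in> I" for j
    using tiling_of_flip(1,2)[OF h x lo hi] that unfolding Y_def Y'_def by blast+
  have keep: "e \<in> Y'" if "e \<in> Y" "\<And>j. j \<in> I \<Longrightarrow> e \<noteq> edge (x - g j) j" for e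
    using tiling_of_flip(3)[OF h x lo hi] that unfolding Y_def Y'_def by blast
  have xL: "x \<in> L" using x region_subset by blast
  have c: "cyclic (\<Xi> j) permutes I" if "j \<in> J" for j by (rule cyclic_permutes[OF \<Xi>_permutes[OF that]])
  define \<pi> where "\<pi> j = succ_dir (cyclic (\<Xi> j))" for j
  have \<pi>: "\<pi> j permutes I" if "j \<in> J" for j unfolding \<pi>_def by (rule succ_dir_permutes[OF c[OF that]])
  have loop_\<pi>: "loop_at (\<Xi> m) (edge x (\<pi> m j)) = loop_at (\<Xi> m) (edge (x - g j) j)"
    if "m \<in> J" "j \<in> I" for m j
    unfolding \<pi>_def by (rule loop_at_succ[OF \<Xi>_permutes[OF that(1)] xL that(2)])
  \<comment> \<open>\<open>\<theta> j\<close> is the direction in which the class-\<open>i\<close>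
    loop that leaves \<open>x\<close> along \<open>\<pi> 1 j\<close> has entered
    \<open>x\<close>.\<close>
  define \<theta> where "\<theta> = inv (\<pi> i) \<circ> \<pi> 1"
  have \<theta>: "\<theta> permutes I" unfolding \<theta>_def by (intro permutes_compose permutes_inv \<pi> one_in_J i)
  have \<theta>_eq: "\<pi> i (\<theta> j) = \<pi> 1 j" for j
    unfolding \<theta>_def comp_def by (rule permutes_inverses(1)[OF \<pi>[OF i]])
  \<comment> \<open>\<open>a j\<close> is the index of the class-\<open>i\<close> loop that enters
    \<open>x\<close> in direction \<open>j\<close>. Along this injective labelling
    \<open>\<theta>\<close> is transported below to the permutation \<open>\<kappa>\<close> of
    indices, with the same sign.\<close>
  define a where "a j = inv_into N (\<nu> i) (loop_at (\<Xi> i) (edge (x - g j) j))" for j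
  have eR: "edge (x - g j) j \<in> ER" if "j \<in> I" for j
    using edge_in_region_edges[OF lattice_diff_gen[OF xL that] that] x by simp
  have a: "a j \<in> N" "\<nu> i (a j) = loop_at (\<Xi> i) (edge (x - g j) j)" if "j \<in> I" for j
    unfolding a_def
    by (rule index_in \<nu>_index, rule i, rule loop_at_in_cls[OF Y i flip(1)[OF that] eR[OF that]])+
  have edge_of_a: "edge_of Y (\<nu> i (a j)) = edge (x - g j) j" if "j \<in> I" for j
    unfolding a(2)[OF that] by (rule edge_of_loop_at[OF t \<Xi>_permutes[OF i] flip(1)[OF that]])
  have inj: "inj_on a I"
  proof (rule inj_onI)
    fix j j' assume j: "j \<in> I" "j' \<in> I" "a j = a j'"
    then have "edge (x - g j) j = edge (x - g j') j'" using edge_of_a by metis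
    then show "j = j'" using edge_inject[OF j(1,2)] by blast
  qed
  define \<kappa> where "\<kappa> = map_permutation I a \<theta>"
  have \<kappa>: "\<kappa> permutes a ` I"
    unfolding \<kappa>_def by (rule map_permutation_permutes[OF inj_on_imp_bij_betw[OF inj] \<theta>])
  have aN: "a ` I \<subseteq> N" using a(1) by blast
  have "perm Y' i k = \<kappa> (perm Y i k)" for k
  proof (cases "k \<in> N")
    case False
    then have "k \<notin> a ` I" using aN by blast
    moreover have "perm Z i k = k" for Z unfolding perm_def using False by (rule if_not_P)
    ultimately show ?thesis using permutes_not_in[OF \<kappa>] by simp
  next
    case k: True
    define e where "e = edge_of Y (\<nu> 1 k)"
    have e: "e \<in> Y" "e \<in> ER" unfolding e_def using edge_of_\<nu>_in[OF Y k] by blast+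
    have \<nu>1: "\<nu> 1 k = loop_at (\<Xi> 1) e"
      unfolding e_def using loop_at_edge_of[OF t one_in_J \<nu>_in_cls[OF one_in_J k]] by simp
    show ?thesis
    proof (cases "\<exists>j\<in>I. e = edge (x - g j) j")
      case True
      then obtain j where j: "j \<in> I" "e = edge (x - g j) j" by blast
      have \<pi>j: "\<pi> 1 j \<in> I" by (rule perm_I[OF \<pi>[OF one_in_J] j(1)])
      have \<theta>j: "\<theta> j \<in> I" by (rule perm_I[OF \<theta> j(1)])
      have "\<nu> 1 k = loop_at (\<Xi> 1) (edge x (\<pi> 1 j))"
        unfolding \<nu>1 j(2) by (rule loop_\<pi>[OF one_in_J j(1), symmetric])
      then have "edge_of Y' (\<nu> 1 k) = edge x (\<pi> 1 j)"
        using edge_of_loop_at[OF t' \<Xi>_permutes[OF one_in_J] flip(2)[OF \<pi>j]] by simp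
      then have "\<nu> i (perm Y' i k) = loop_at (\<Xi> i) (edge x (\<pi> i (\<theta> j)))"
        unfolding \<nu>_perm[OF Y' i k] \<theta>_eq by simp
      also have "\<dots> = \<nu> i (a (\<theta> j))" unfolding loop_\<pi>[OF i \<theta>j] a(2)[OF \<theta>j] ..
      finally have "perm Y' i k = a (\<theta> j)"
        by (rule \<nu>_inject[OF i perm_in[OF Y' i k] a(1)[OF \<theta>j]])
      moreover have "\<nu> i (perm Y i k) = \<nu> i (a j)"
        unfolding \<nu>_perm[OF Y i k] a(2)[OF j(1)] e_def[symmetric] j(2) ..
      then have "perm Y i k = a j" by (rule \<nu>_inject[OF i perm_in[OF Y i k] a(1)[OF j(1)]])
      moreover have "\<kappa> (a j) = a (\<theta> j)" unfolding \<kappa>_def by (rule map_permutation_apply[OF inj j(1)])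
      ultimately show ?thesis by simp
    next
      case False
      then have "e \<in> Y'" by (intro keep[OF e(1)]) blast
      then have "edge_of Y' (\<nu> 1 k) = e"
        unfolding \<nu>1 by (rule edge_of_loop_at[OF t' \<Xi>_permutes[OF one_in_J]])
      then have "perm Y' i k = perm Y i k" by (simp add: perm_def e_def)
      \<comment> \<open>\<open>\<kappa>\<close> fixes every index that is not of the form
        \<open>a j\<close>, and an index \<open>a j\<close> would force \<open>e\<close> to be an
        edge entering \<open>x\<close>.\<close>
      moreover have "perm Y i k \<notin> a ` I"
      proof
        assume "perm Y i k \<in> a ` I"
        then obtain j where j: "j \<in> I" "perm Y i k = a j" by blast
        then have "edge_of Y (loop_at (\<Xi> i) e) = edge (x - g j) j"
          using edge_of_a[OF j(1)] \<nu>_perm[OF Y i k] by (simp add: e_def)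
        then have "e = edge (x - g j) j" using edge_of_loop_at[OF t \<Xi>_permutes[OF i] e(1)] by simp
        then show False using False j(1) by blast
      qed
      ultimately show ?thesis using permutes_not_in[OF \<kappa>] by simp
    qed
  qed
  then have "perm Y' i = \<kappa> \<circ> perm Y i" by (simp add: fun_eq_iff)
  moreover have "permutation \<kappa>" by (rule permutes_imp_permutation[OF _ \<kappa>]) simp
  moreover have "permutation (perm Y i)"
    by (rule permutes_imp_permutation[OF _ perm_permutes[OF Y i]]) simp
  moreover have "sign \<kappa> = 1"
  proof -
    have "sign \<kappa> = sign \<theta>" unfolding \<kappa>_def by (rule sign_map_permutation[OF inj \<theta>]) simp
    also have "\<dots> = sign (inv (\<pi> i)) * sign (\<pi> 1)"
      unfolding \<theta>_def by (intro sign_compose permutation_I permutes_inv \<pi> i one_in_J)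
    also have "sign (inv (\<pi> i)) = sign (\<pi> i)" by (rule sign_inverse[OF permutation_I[OF \<pi>[OF i]]])
    finally show ?thesis
      unfolding \<pi>_def sign_succ_dir[OF c[OF i]] sign_succ_dir[OF c[OF one_in_J]] by simp
  qed
  ultimately show ?thesis unfolding Y_def[symmetric] Y'_def[symmetric] by (simp add: sign_compose)
qed

lemma sign_perm_eq:
  assumes "Y \<in> \<Theta>" "Y' \<in> \<Theta>" "i \<in> J"
  shows "sign (perm Y i) = sign (perm Y' i)"
proof -
  obtain h h' where h: "h \<in> \<Omega>" "Y = tiling_of d h" "h' \<in> \<Omega>" "Y' = tiling_of d h'"
    using tiling_of_surj assms(1,2) by metis
  show ?thesis
    unfolding h(2,4)
    by (rule flip_invariant[where s = "\<lambda>h. sign (perm (tiling_of d h) i)", OF _ h(1,3)])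
      (rule sign_perm_flip, assumption+, rule assms(3))
qed

subsection \<open>The terms of the hyperdeterminant\<close>

text \<open>Cayley's sum runs over permutations for the indices from 2 on; the missing first one is
  the identity.\<close>

definition ext_perm :: "(nat \<Rightarrow> nat \<Rightarrow> nat) \<Rightarrow> nat \<Rightarrow> nat \<Rightarrow> nat" where
  "ext_perm \<sigma> i k = (if i = 1 then k else \<sigma> i k)"

text \<open>Entries are 0 or 1, so these are exactly the families whose term in the hyperdeterminant
  does not vanish.\<close>

definition matchings :: "(nat \<Rightarrow> nat \<Rightarrow> nat) set" where
  "matchings = {\<sigma> \<in> {2..fact d} \<rightarrow>\<^sub>E {p. p permutes N}.
    \<forall>k\<in>N. (\<lambda>i. \<nu> i (ext_perm \<sigma> i k)) ` J \<in> hyperedge d ` ER}"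

lemma finite_perm_families: "finite ({2..fact d :: nat} \<rightarrow>\<^sub>E {p. p permutes N})"
  by (intro finite_PiE) (auto intro: finite_permutations)

lemma ext_perm_permutes:
  assumes "\<sigma> \<in> {2..fact d} \<rightarrow>\<^sub>E {p. p permutes N}" "i \<in> J"
  shows "ext_perm \<sigma> i permutes N"
proof (cases "i = 1")
  case True
  then have "ext_perm \<sigma> i = id" by (simp add: ext_perm_def fun_eq_iff)
  then show ?thesis by (simp add: permutes_id)
next
  case False
  then have "i \<in> {2..fact d}" using assms(2) by auto
  then have "\<sigma> i permutes N" using assms(1) by blast
  moreover have "ext_perm \<sigma> i = \<sigma> i" using False by (simp add: ext_perm_def fun_eq_iff)
  ultimately show ?thesis by simp
qed

lemma kasteleyn_entry:
  assumes "\<sigma> \<in> {2..fact d} \<rightarrow>\<^sub>E {p. p permutes N}" "k \<in> N"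
  shows "kasteleyn d R T \<Xi> (\<lambda>i\<in>J. \<nu> i ((\<lambda>i\<in>J. if i = 1 then k else \<sigma> i k) i))
    = of_bool ((\<lambda>i. \<nu> i (ext_perm \<sigma> i k)) ` J \<in> hyperedge d ` ER)"
proof -
  have eq: "(\<lambda>i\<in>J. \<nu> i ((\<lambda>i\<in>J. if i = 1 then k else \<sigma> i k) i)) = (\<lambda>i\<in>J. \<nu> i (ext_perm \<sigma> i k))"
    by (rule restrict_ext) (simp add: ext_perm_def)
  \<comment> \<open>Outside this product the extensional \<open>kasteleyn\<close> has the value
    \<open>undefined\<close>, so membership must precede evaluation.\<close>
  have "(\<lambda>i\<in>J. \<nu> i (ext_perm \<sigma> i k)) \<in> (\<Pi>\<^sub>E i\<in>J. cls i)"
  proof (rule restrict_PiE_iff[THEN iffD2], rule ballI)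
    fix i assume i: "i \<in> J"
    have "ext_perm \<sigma> i k \<in> N"
      using permutes_in_image[OF ext_perm_permutes[OF assms(1) i]] assms(2) by blast
    then show "\<nu> i (ext_perm \<sigma> i k) \<in> cls i" by (rule \<nu>_in_cls[OF i])
  qed
  moreover have "(\<lambda>i\<in>J. \<nu> i (ext_perm \<sigma> i k)) ` J = (\<lambda>i. \<nu> i (ext_perm \<sigma> i k)) ` J"
    by (rule image_cong) simp_all
  ultimately show ?thesis unfolding eq kasteleyn_def by (simp only: restrict_apply' of_bool_def)
qed

lemma hyperdet_eq:
  "hyperdet (fact d) n (\<lambda>j. kasteleyn d R T \<Xi> (\<lambda>i\<in>J. \<nu> i (j i)))
    = (\<Sum>\<sigma>\<in>matchings. \<Prod>i\<in>{2..fact d}. of_int (sign (\<sigma> i)))"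
proof -
  have "hyperdet (fact d) n (\<lambda>j. kasteleyn d R T \<Xi> (\<lambda>i\<in>J. \<nu> i (j i)))
    = (\<Sum>\<sigma>\<in>{2..fact d} \<rightarrow>\<^sub>E {p. p permutes N}.
        if \<forall>k\<in>N. (\<lambda>i. \<nu> i (ext_perm \<sigma> i k)) ` J \<in> hyperedge d ` ER
        then \<Prod>i\<in>{2..fact d}. of_int (sign (\<sigma> i)) else 0)"
    unfolding hyperdet_def
  proof (rule sum.cong[OF refl])
    fix \<sigma> :: "nat \<Rightarrow> nat \<Rightarrow> nat" assume \<sigma>: "\<sigma> \<in> {2..fact d} \<rightarrow>\<^sub>E {p. p permutes N}"
    define G where "G k \<longleftrightarrow> (\<lambda>i. \<nu> i (ext_perm \<sigma> i k)) ` J \<in> hyperedge d ` ER" for k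
    have "(\<Prod>k\<in>N. kasteleyn d R T \<Xi> (\<lambda>i\<in>J. \<nu> i ((\<lambda>i\<in>J. if i = 1 then k else \<sigma> i k) i)))
        = (\<Prod>k\<in>N. of_bool (G k))"
      unfolding G_def by (intro prod.cong refl kasteleyn_entry[OF \<sigma>])
    also have "\<dots> = (if \<forall>k\<in>N. G k then 1 else 0)"
      by auto
    finally show "(\<Prod>i\<in>{2..fact d}. of_int (sign (\<sigma> i))) *
        (\<Prod>k\<in>N. kasteleyn d R T \<Xi> (\<lambda>i\<in>J. \<nu> i ((\<lambda>i\<in>J. if i = 1 then k else \<sigma> i k) i)))
      = (if \<forall>k\<in>N. (\<lambda>i. \<nu> i (ext_perm \<sigma> i k)) ` J \<in> hyperedge d ` ER
         then \<Prod>i\<in>{2..fact d}. of_int (sign (\<sigma> i)) else 0)"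
      unfolding G_def by simp
  qed
  also have "\<dots> = (\<Sum>\<sigma>\<in>matchings. \<Prod>i\<in>{2..fact d}. of_int (sign (\<sigma> i)))"
    unfolding matchings_def by (rule sum.inter_filter[OF finite_perm_families, symmetric])
  finally show ?thesis .
qed

section \<open>Tilings and the nonzero terms\<close>

definition perms :: "point set set \<Rightarrow> nat \<Rightarrow> nat \<Rightarrow> nat" where
  "perms Y = (\<lambda>i\<in>{2..fact d}. perm Y i)"

lemma ext_perm_perms:
  assumes "Y \<in> \<Theta>" "i \<in> J" "k \<in> N"
  shows "ext_perm (perms Y) i k = perm Y i k"
  using assms perm_1[OF assms(1,3)] by (auto simp: ext_perm_def perms_def)

lemma perms_hyperedge:
  assumes "Y \<in> \<Theta>" "k \<in> N"
  shows "(\<lambda>i. \<nu> i (ext_perm (perms Y) i k)) ` J = hyperedge d (edge_of Y (\<nu> 1 k))"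
proof -
  have "edge_of Y (\<nu> 1 k) \<in> lattice_edges d"
    using edge_of_\<nu>_in(2)[OF assms] region_edges_subset by blast
  from hyperedge_eq[OF this] show ?thesis
    using ext_perm_perms[OF assms(1) _ assms(2)] \<nu>_perm[OF assms(1) _ assms(2)] by simp
qed

lemma perms_in_matchings:
  assumes "Y \<in> \<Theta>"
  shows "perms Y \<in> matchings"
proof -
  have "perm Y i permutes N" if "i \<in> {2..fact d}" for i
    using perm_permutes[OF assms] that by simp
  then have "perms Y \<in> {2..fact d} \<rightarrow>\<^sub>E {p. p permutes N}"
    unfolding perms_def by (intro restrict_PiE_iff[THEN iffD2]) blast
  moreover have "(\<lambda>i. \<nu> i (ext_perm (perms Y) i k)) ` J \<in> hyperedge d ` ER" if "k \<in> N" for k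
    unfolding perms_hyperedge[OF assms that] using edge_of_\<nu>_in(2)[OF assms that] by blast
  ultimately show ?thesis unfolding matchings_def by blast
qed

text \<open>The family determines the hyperedge of each edge of the tiling in \<open>ER\<close>,
  \<open>hyperedge_inject\<close> recovers the edge, and outside \<open>ER\<close> both tilings
  agree with \<open>T\<close>.\<close>

lemma inj_on_perms: "inj_on perms \<Theta>"
proof (rule inj_onI)
  fix Y Y' assume Y: "Y \<in> \<Theta>" "Y' \<in> \<Theta>" and eq: "perms Y = perms Y'"
  have "edge_of Y (\<nu> 1 k) = edge_of Y' (\<nu> 1 k)" if k: "k \<in> N" for k
  proof (rule hyperedge_inject)
    show "edge_of Y (\<nu> 1 k) \<in> lattice_edges d" "edge_of Y' (\<nu> 1 k) \<in> lattice_edges d"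
      using edge_of_\<nu>_in(2)[OF _ k] Y region_edges_subset by blast+
    show "hyperedge d (edge_of Y (\<nu> 1 k)) = hyperedge d (edge_of Y' (\<nu> 1 k))"
      using perms_hyperedge[OF Y(1) k] perms_hyperedge[OF Y(2) k] eq by simp
  qed
  then have "Y \<inter> ER = Y' \<inter> ER"
    unfolding region_part_eq[OF Y(1)] region_part_eq[OF Y(2)] by (intro image_cong refl)
  then show "Y = Y'" using tilings_onD(2)[OF Y(1)] tilings_onD(2)[OF Y(2)] by blast
qed

text \<open>The tiling consists of the edges named by the \<open>n\<close> hyperedges together with
  \<open>T - ER\<close>. A loop whose \<open>T\<close>-edge lies in \<open>ER\<close> has an index
  in its class, and that index is hit by exactly one \<open>k\<close> because
  \<open>ext_perm \<sigma> i\<close> is a permutation. Any other loop keeps its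
  \<open>T\<close>-edge and meets none of the new edges, which within each class only traverse
  indexed loops.\<close>

lemma matching_is_perms:
  assumes \<sigma>: "\<sigma> \<in> matchings"
  shows "\<exists>Y\<in>\<Theta>. perms Y = \<sigma>"
proof -
  have \<sigma>P: "\<sigma> \<in> {2..fact d} \<rightarrow>\<^sub>E {p. p permutes N}" using \<sigma> by (simp add: matchings_def)
  have "\<forall>k\<in>N. \<exists>e\<in>ER. (\<lambda>i. \<nu> i (ext_perm \<sigma> i k)) ` J = hyperedge d e"
    using \<sigma> unfolding matchings_def by blast
  then obtain e where e: "\<And>k. k \<in> N \<Longrightarrow> e k \<in> ER"
    and e_eq: "\<And>k. k \<in> N \<Longrightarrow> (\<lambda>i. \<nu> i (ext_perm \<sigma> i k)) ` J = hyperedge d (e k)"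
    by metis
  have ext_N: "ext_perm \<sigma> i k \<in> N" if "i \<in> J" "k \<in> N" for i k
    using permutes_in_image[OF ext_perm_permutes[OF \<sigma>P that(1)]] that(2) by blast
  \<comment> \<open>The loops of a hyperedge are listed class by class; as \<open>\<Xi>\<close> is
    injective, the class of \<open>l\<close> singles out the one entry that it can equal.\<close>
  have traverses: "e k \<in> loop_edges d l \<longleftrightarrow> l = \<nu> i (ext_perm \<sigma> i k)"
    if "k \<in> N" "i \<in> J" "l \<in> loops d" "snd l = \<Xi> i" for k i l
  proof
    assume "e k \<in> loop_edges d l"
    then have "l \<in> (\<lambda>i. \<nu> i (ext_perm \<sigma> i k)) ` J"
      unfolding e_eq[OF that(1)] hyperedge_def using that(3) by blast
    then obtain j where j: "j \<in> J" "l = \<nu> j (ext_perm \<sigma> j k)" by blast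
    then have "snd l = \<Xi> j" using \<nu>_in_cls[OF j(1) ext_N[OF j(1) that(1)]] in_cls_iff[OF j(1)] by blast
    then have "j = i" using that(2,4) j(1) bij_betw_imp_inj_on[OF \<Xi>] by (metis inj_onD)
    then show "l = \<nu> i (ext_perm \<sigma> i k)" using j(2) by simp
  next
    assume "l = \<nu> i (ext_perm \<sigma> i k)"
    then have "l \<in> hyperedge d (e k)" using e_eq[OF that(1)] that(2) by blast
    then show "e k \<in> loop_edges d l" by (simp add: hyperedge_def)
  qed
  define Y where "Y = e ` N \<union> (T - ER)"
  have "card (Y \<inter> loop_edges d l) = 1" if l: "l \<in> loops d" for l
  proof -
    have "snd l \<in> \<Xi> ` J"
      using l bij_betw_imp_surj_on[OF \<Xi>] by (auto simp: loops_def)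
    then obtain i where i: "i \<in> J" "snd l = \<Xi> i" by blast
    define u where "u = edge_of T l"
    have u: "u \<in> T" "u \<in> loop_edges d l" "\<And>e. e \<in> T \<Longrightarrow> e \<in> loop_edges d l \<Longrightarrow> e = u"
      unfolding u_def using edge_of_in[OF tiling_in_tilings l] edge_of_eqI[OF tiling_in_tilings l] by blast+
    show ?thesis
    proof (cases "u \<in> ER")
      case True
      then have "l \<in> cls i" using in_cls_iff[OF i(1)] l i(2) u by blast
      then obtain b where b: "b \<in> N" "l = \<nu> i b" using bij_betw_imp_surj_on[OF \<nu>[OF i(1)]] by blast
      note p = ext_perm_permutes[OF \<sigma>P i(1)]
      have "b \<in> ext_perm \<sigma> i ` N" using b(1) unfolding permutes_image[OF p] .
      then obtain k where k: "k \<in> N" "b = ext_perm \<sigma> i k" by blast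
      have "e k' \<in> loop_edges d l \<longleftrightarrow> k' = k" if "k' \<in> N" for k'
      proof -
        have "e k' \<in> loop_edges d l \<longleftrightarrow> \<nu> i (ext_perm \<sigma> i k) = \<nu> i (ext_perm \<sigma> i k')"
          using traverses[OF that i(1) l i(2)] unfolding b(2) k(2) .
        also have "\<dots> \<longleftrightarrow> ext_perm \<sigma> i k = ext_perm \<sigma> i k'"
          using \<nu>_inject[OF i(1) ext_N[OF i(1) k(1)] ext_N[OF i(1) that]] by auto
        also have "\<dots> \<longleftrightarrow> k' = k" using permutes_inj[OF p] by (auto dest: injD)
        finally show ?thesis .
      qed
      moreover have "(T - ER) \<inter> loop_edges d l = {}" using u(3) True by blast
      ultimately have "Y \<inter> loop_edges d l = {e k}" unfolding Y_def using k(1) by blast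
      then show ?thesis by simp
    next
      case False
      have "e k \<notin> loop_edges d l" if "k \<in> N" for k
      proof
        assume "e k \<in> loop_edges d l"
        then have "l \<in> cls i"
          using traverses[OF that i(1) l i(2)] \<nu>_in_cls[OF i(1) ext_N[OF i(1) that]] by simp
        then show False using False in_cls_iff[OF i(1)] u(3) by blast
      qed
      then have "Y \<inter> loop_edges d l = {u}" unfolding Y_def using u False by blast
      then show ?thesis by simp
    qed
  qed
  moreover have "Y \<subseteq> lattice_edges d"
    using e region_edges_subset tiling_of_subset unfolding Y_def by blast
  moreover have "Y - ER = T - ER" using e unfolding Y_def by blast
  ultimately have Y: "Y \<in> \<Theta>" unfolding tilings_on_def tilings_iff by blast
  have "perm Y i k = \<sigma> i k" if i: "i \<in> {2..fact d}" for i k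
  proof (cases "k \<in> N")
    case False
    have "\<sigma> i permutes N" using \<sigma>P i by blast
    then show ?thesis using False permutes_not_in by (fastforce simp: perm_def)
  next
    case k: True
    have iJ: "i \<in> J" and i1: "i \<noteq> 1" using i by auto
    have snd\<nu>: "\<nu> j m \<in> loops d" "snd (\<nu> j m) = \<Xi> j" if "j \<in> J" "m \<in> N" for j m
      using \<nu>_in_cls[OF that] in_cls_iff[OF that(1)] by blast+
    have "e k \<in> loop_edges d (\<nu> 1 k)"
      using traverses[OF k one_in_J snd\<nu>[OF one_in_J k]] by (simp add: ext_perm_def)
    then have "edge_of Y (\<nu> 1 k) = e k"
      using k by (intro edge_of_eqI[OF tilings_onD(1)[OF Y] snd\<nu>(1)[OF one_in_J k]]) (auto simp: Y_def)
    then have "\<nu> i (perm Y i k) = loop_at (\<Xi> i) (e k)" by (simp only: \<nu>_perm[OF Y iJ k])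
    also have "\<dots> = \<nu> i (ext_perm \<sigma> i k)"
    proof -
      note s = snd\<nu>[OF iJ ext_N[OF iJ k]]
      have "e k \<in> lattice_edges d" using e[OF k] region_edges_subset by blast
      moreover have "e k \<in> loop_edges d (\<nu> i (ext_perm \<sigma> i k))" using traverses[OF k iJ s] by blast
      ultimately show ?thesis using in_loop_edges_iff[OF \<Xi>_permutes[OF iJ] _ s] by simp
    qed
    finally have "perm Y i k = ext_perm \<sigma> i k"
      by (rule \<nu>_inject[OF iJ perm_in[OF Y iJ k] ext_N[OF iJ k]])
    then show ?thesis using i1 by (simp add: ext_perm_def)
  qed
  then have "perm Y i = \<sigma> i" if "i \<in> {2..fact d}" for i using that by blast
  then have "perms Y = \<sigma>"
    unfolding perms_def using \<sigma>P by (auto simp: fun_eq_iff restrict_def PiE_iff extensional_def)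
  with Y show ?thesis by blast
qed

lemma bij_betw_perms: "bij_betw perms \<Theta> matchings"
  unfolding bij_betw_def using inj_on_perms perms_in_matchings matching_is_perms by blast

text \<open>The common sign \<open>c\<close> is that of the term belonging to \<open>T\<close>. It
  depends on the enumerations \<open>\<nu>\<close>, which is why the sign in the conclusion stays
  open.\<close>

lemma hyperdet_eq_card:
  "of_nat (card \<Theta>) = hyperdet (fact d) n (\<lambda>j. kasteleyn d R T \<Xi> (\<lambda>i\<in>J. \<nu> i (j i))) \<or>
   of_nat (card \<Theta>) = - hyperdet (fact d) n (\<lambda>j. kasteleyn d R T \<Xi> (\<lambda>i\<in>J. \<nu> i (j i)))"
proof -
  define c :: int where "c = (\<Prod>i\<in>{2..fact d}. sign (perm T i))"
  have T: "T \<in> \<Theta>" using tiling_in_tilings by (simp add: tilings_on_def)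
  have "(\<Sum>\<sigma>\<in>matchings. \<Prod>i\<in>{2..fact d}. of_int (sign (\<sigma> i)))
      = (\<Sum>Y\<in>\<Theta>. \<Prod>i\<in>{2..fact d}. of_int (sign (perms Y i)) :: complex)"
    by (rule sum.reindex_bij_betw[OF bij_betw_perms, symmetric])
  also have "\<dots> = (\<Sum>Y\<in>\<Theta>. of_int c)"
  proof (rule sum.cong[OF refl])
    fix Y assume Y: "Y \<in> \<Theta>"
    have "sign (perms Y i) = sign (perm T i)" if "i \<in> {2..fact d}" for i
      using sign_perm_eq[OF Y T, of i] that by (simp add: perms_def)
    then show "(\<Prod>i\<in>{2..fact d}. of_int (sign (perms Y i))) = (of_int c :: complex)"
      unfolding c_def of_int_prod by (intro prod.cong) simp_all
  qed
  finally have det: "hyperdet (fact d) n (\<lambda>j. kasteleyn d R T \<Xi> (\<lambda>i\<in>J. \<nu> i (j i)))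
      = of_nat (card \<Theta>) * of_int c"
    unfolding hyperdet_eq by simp
  have "c * c = 1" unfolding c_def prod.distrib[symmetric] by simp
  then have "c = 1 \<or> c = - 1" by (simp add: square_eq_1_iff)
  then show ?thesis unfolding det by auto
qed

end

theorem theorem6p19:
  fixes d n :: nat
    and R :: "point set"
    and f :: "point \<Rightarrow> int"
    and T :: "point set set"
    and \<Xi> :: "nat \<Rightarrow> nat \<Rightarrow> nat"
    and \<nu> :: "nat \<Rightarrow> nat \<Rightarrow> simplicial_loop"
    and Z :: real
    and K :: "(nat \<Rightarrow> nat) \<Rightarrow> complex"
  assumes "d \<ge> 2"
    and "region d R"
    and "f \<in> height_functions d"
    and "T = tiling_of d f"
    and "n = card (T \<inter> region_edges d R)"
    and "bij_betw \<Xi> {1..fact d} {\<xi>. \<xi> permutes {1..d}}"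
    and "\<And>i. i \<in> {1..fact d} \<Longrightarrow> bij_betw (\<nu> i) {1..n} (loop_class d R T (\<Xi> i))"
    and "K = (\<lambda>j. kasteleyn d R T \<Xi> (\<lambda>i\<in>{1..fact d}. \<nu> i (j i)))"
    and "Z = partition_fun d R T (\<lambda>e. 1)"
  shows "finite (height_functions_on d R f) \<and> finite (tilings_on d R T) \<and>
    Z = real (card (height_functions_on d R f)) \<and>
    card (height_functions_on d R f) = card (tilings_on d R T) \<and>
    (of_nat (card (tilings_on d R T)) = hyperdet (fact d) n K \<or>
     of_nat (card (tilings_on d R T)) = - hyperdet (fact d) n K)"
proof -
  interpret kasteleyn_region d R f n \<Xi> \<nu>
    using assms(1-3,6,7) unfolding assms(4) by unfold_locales
  have card: "card (height_functions_on d R f) = card (tilings_on d R T)"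
    unfolding assms(4) by (rule bij_betw_same_card[OF bij_betw_tiling_of])
  moreover have "finite (tilings_on d R T)" "finite (height_functions_on d R f)"
    unfolding assms(4) using finite_tilings_on bij_betw_finite[OF bij_betw_tiling_of] by blast+
  moreover have "Z = real (card (tilings_on d R T))"
    unfolding assms(9) by (simp add: partition_fun_def)
  ultimately show ?thesis
    unfolding assms(8) using hyperdet_eq_card[folded assms(4)] by simp
qed

end
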